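(* Let $K\ge1$. Suppose that $f(z)=h(z)+\overline{g(z)}=\sum_{n=0}^\infty a_n z^n+\overline{\sum_{n=2}^\infty b_n z^n}$ is a sense-preserving $K$-quasiconformal harmonic mapping of the unit disk $\mathbb{D}$, where $h$ is bounded in $\mathbb{D}$. Then $$\sum_{n=0}^\infty |a_n|r^n+\sum_{n=2}^\infty |b_n|r^n\le\|h\|_\infty\quad\text{for } 0\le r\le r_K,$$ where $r_K\in(0,1)$ is the positive root of the equation $M_K(r)=1/2$ and $$M_K(r)=\frac{r}{1-r}+\left(\frac{K-1}{K+1}\right)r^2\sqrt{\frac{1+r^2}{(1-r^2)^3}}\sqrt{\frac{\pi^2}{6}-1}.$$ The number $r_K$ cannot be replaced by a number greater than $R=R(K)$, where $R\in(0,1)$ is the positive root of the equation $$\frac{4R}{1-R}\left(\frac{K}{K+1}\right)+2\left(\frac{K-1}{K+1}\right)\log(1-R)=1;$$ that is, for every $r\in(R(K),1)$ there is such an $f$ for which the inequality fails at $r$.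
   Context: $\mathbb{D}=\{z\in\mathbb{C}:|z|<1\}$ and $\|h\|_\infty=\sup_{z\in\mathbb{D}}|h(z)|$. A harmonic mapping in $\mathbb{D}$ is a complex-valued function $f$ with $\Delta f=0$; it is written $f=h+\overline{g}$ with $h,g$ analytic in $\mathbb{D}$ and $g(0)=0$; here $h(z)=\sum_{n\ge0}a_nz^n$ and $g(z)=\sum_{n\ge2}b_nz^n$ (so $g(0)=g'(0)=0$). It is (locally univalent and) sense-preserving if its Jacobian $J_f=|h'|^2-|g'|^2$ is positive in $\mathbb{D}$; equivalently $h'\neq0$ and the dilatation $\omega_f=g'/h'$ satisfies $|\omega_f|<1$ in $\mathbb{D}$. A sense-preserving homeomorphism $f$ of $\mathbb{D}$ onto a domain $\Omega'$, belonging to $W^{1,2}_{loc}(\mathbb{D})$, is $K$-quasiconformal ($K\ge1$) if $\frac{|f_z|+|f_{\bar z}|}{|f_z|-|f_{\bar z}|}\le K$ in $\mathbb{D}$; for harmonic $f=h+\overline g$ this means $|\omega_f(z)|\le k=\frac{K-1}{K+1}$ for $z\in\mathbb{D}$. *)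

theory Defs
  imports "HOL-Complex_Analysis.Complex_Analysis"
begin

abbreviation unit_disk :: "complex set" ("\<D>") where
  "\<D> \<equiv> ball 0 1"

text \<open>The partial derivatives with respect to \<open>x\<close> and \<open>y\<close> are those in the directions
  \<open>1\<close> and \<open>\<i>\<close>.  They are meaningful only where the function is differentiable.\<close>

definition pd :: "complex \<Rightarrow> (complex \<Rightarrow> 'a::real_normed_vector) \<Rightarrow> complex \<Rightarrow> 'a" where
  "pd v f z = frechet_derivative f (at z) v"

definition C1_on :: "complex set \<Rightarrow> (complex \<Rightarrow> 'a::real_normed_vector) \<Rightarrow> bool" where
  "C1_on S f \<longleftrightarrow> (\<forall>z\<in>S. f differentiable (at z)) \<and> (\<forall>v. continuous_on S (pd v f))"

definition laplacian :: "(complex \<Rightarrow> complex) \<Rightarrow> complex \<Rightarrow> complex" where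
  "laplacian f z = pd 1 (pd 1 f) z + pd \<i> (pd \<i> f) z"

definition harmonic_on :: "complex set \<Rightarrow> (complex \<Rightarrow> complex) \<Rightarrow> bool" where
  "harmonic_on S f \<longleftrightarrow>
     C1_on S f \<and> C1_on S (pd 1 f) \<and> C1_on S (pd \<i> f) \<and> (\<forall>z\<in>S. laplacian f z = 0)"

definition dz :: "(complex \<Rightarrow> complex) \<Rightarrow> complex \<Rightarrow> complex" where
  "dz f z = (pd 1 f z - \<i> * pd \<i> f z) / 2"

definition dzbar :: "(complex \<Rightarrow> complex) \<Rightarrow> complex \<Rightarrow> complex" where
  "dzbar f z = (pd 1 f z + \<i> * pd \<i> f z) / 2"

definition jacobian :: "(complex \<Rightarrow> complex) \<Rightarrow> complex \<Rightarrow> real" where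
  "jacobian f z = (norm (dz f z))\<^sup>2 - (norm (dzbar f z))\<^sup>2"

definition sense_preserving :: "(complex \<Rightarrow> complex) \<Rightarrow> bool" where
  "sense_preserving f \<longleftrightarrow> (\<forall>z\<in>\<D>. f differentiable (at z) \<and> jacobian f z > 0)"

definition L2_loc :: "complex set \<Rightarrow> (complex \<Rightarrow> complex) \<Rightarrow> bool" where
  "L2_loc S u \<longleftrightarrow> u \<in> borel_measurable (lebesgue_on S) \<and>
     (\<forall>C. compact C \<and> C \<subseteq> S \<longrightarrow> integrable (lebesgue_on C) (\<lambda>z. (norm (u z))\<^sup>2))"

definition test_function :: "complex set \<Rightarrow> (complex \<Rightarrow> real) \<Rightarrow> bool" where
  "test_function S \<phi> \<longleftrightarrow>
     C1_on UNIV \<phi> \<and> (\<exists>C. compact C \<and> C \<subseteq> S \<and> (\<forall>z. z \<notin> C \<longrightarrow> \<phi> z = 0))"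

text \<open>Weak derivatives of first order are tested against \<open>C\<^sup>1\<close> functions of compact support;
  for locally integrable functions this is the same as testing against \<open>C\<^sup>\<infinity>\<close> functions.\<close>

definition weak_pd :: "complex set \<Rightarrow> complex \<Rightarrow> (complex \<Rightarrow> complex) \<Rightarrow> (complex \<Rightarrow> complex) \<Rightarrow> bool"
  where
  "weak_pd S v f u \<longleftrightarrow> (\<forall>\<phi>. test_function S \<phi> \<longrightarrow>
     (LINT z|lebesgue_on S. pd v \<phi> z *\<^sub>R f z) = - (LINT z|lebesgue_on S. \<phi> z *\<^sub>R u z))"

definition W12_loc :: "complex set \<Rightarrow> (complex \<Rightarrow> complex) \<Rightarrow> bool" where
  "W12_loc S f \<longleftrightarrow> L2_loc S f \<and>
     (\<exists>u v. L2_loc S u \<and> L2_loc S v \<and> weak_pd S 1 f u \<and> weak_pd S \<i> f v)"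

text \<open>The dilatation condition is imposed at every point, with classical derivatives; this suits
  harmonic maps, which are smooth.  The denominator is positive because the Jacobian is.\<close>

definition quasiconformal :: "real \<Rightarrow> (complex \<Rightarrow> complex) \<Rightarrow> bool" where
  "quasiconformal K f \<longleftrightarrow>
     sense_preserving f \<and>
     (\<exists>\<Omega> finv. open \<Omega> \<and> connected \<Omega> \<and> homeomorphism \<D> \<Omega> f finv) \<and>
     W12_loc \<D> f \<and>
     (\<forall>z\<in>\<D>. (norm (dz f z) + norm (dzbar f z)) / (norm (dz f z) - norm (dzbar f z)) \<le> K)"

text \<open>The values \<open>b 0\<close> and \<open>b 1\<close> are irrelevant: the expansion of \<open>g\<close> starts at \<open>n = 2\<close>.\<close>

definition bounded_qc_harmonic ::
  "real \<Rightarrow> (complex \<Rightarrow> complex) \<Rightarrow> (complex \<Rightarrow> complex) \<Rightarrow> (complex \<Rightarrow> complex) \<Rightarrow>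
   (nat \<Rightarrow> complex) \<Rightarrow> (nat \<Rightarrow> complex) \<Rightarrow> bool" where
  "bounded_qc_harmonic K f h g a b \<longleftrightarrow>
     h holomorphic_on \<D> \<and> g holomorphic_on \<D> \<and>
     (\<forall>z\<in>\<D>. f z = h z + cnj (g z)) \<and>
     (\<forall>z\<in>\<D>. (\<lambda>n. a n * z ^ n) sums h z) \<and>
     (\<forall>z\<in>\<D>. (\<lambda>n. b (n + 2) * z ^ (n + 2)) sums g z) \<and>
     harmonic_on \<D> f \<and> sense_preserving f \<and> quasiconformal K f \<and>
     bounded (h ` \<D>)"

definition sup_norm :: "(complex \<Rightarrow> complex) \<Rightarrow> real" where
  "sup_norm h = (SUP z\<in>\<D>. norm (h z))"

text \<open>Both series converge for \<open>0 \<le> r < 1\<close> when \<open>a\<close> and \<open>b\<close> are coefficients of power series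
  converging in the unit disk.\<close>

definition bohr_sum :: "(nat \<Rightarrow> complex) \<Rightarrow> (nat \<Rightarrow> complex) \<Rightarrow> real \<Rightarrow> real" where
  "bohr_sum a b r = (\<Sum>n. norm (a n) * r ^ n) + (\<Sum>n. norm (b (n + 2)) * r ^ (n + 2))"

definition M :: "real \<Rightarrow> real \<Rightarrow> real" where
  "M K r = r / (1 - r) +
     (K - 1) / (K + 1) * r\<^sup>2 * sqrt ((1 + r\<^sup>2) / (1 - r\<^sup>2) ^ 3) * sqrt (pi\<^sup>2 / 6 - 1)"

definition is_rK :: "real \<Rightarrow> real \<Rightarrow> bool" where
  "is_rK K r \<longleftrightarrow> 0 < r \<and> r < 1 \<and> M K r = 1 / 2"

definition is_R :: "real \<Rightarrow> real \<Rightarrow> bool" where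
  "is_R K R \<longleftrightarrow> 0 < R \<and> R < 1 \<and>
     4 * R / (1 - R) * (K / (K + 1)) + 2 * ((K - 1) / (K + 1)) * ln (1 - R) = 1"

text \<open>Consistency with the representation by \<open>h\<close> and \<open>g\<close>: the function \<open>h + cnj g\<close> is harmonic,
  and its Wirtinger derivatives are \<open>h'\<close> and \<open>cnj g'\<close>, so that its Jacobian is
  \<open>\<bar>h'\<bar>\<^sup>2 - \<bar>g'\<bar>\<^sup>2\<close>.\<close>

lemma has_derivative_harmonic:
  assumes "open S" "h holomorphic_on S" "g holomorphic_on S"
    and f: "\<And>z. z \<in> S \<Longrightarrow> f z = h z + cnj (g z)" and z: "z \<in> S"
  shows "(f has_derivative (\<lambda>v. deriv h z * v + cnj (deriv g z * v))) (at z)"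
proof -
  have "(h has_derivative (\<lambda>v. deriv h z * v)) (at z)"
       "(g has_derivative (\<lambda>v. deriv g z * v)) (at z)"
    using holomorphic_derivI[OF assms(2,1) z] holomorphic_derivI[OF assms(3,1) z]
    by (auto simp: has_field_derivative_def)
  then have "((\<lambda>z. h z + cnj (g z)) has_derivative
      (\<lambda>v. deriv h z * v + cnj (deriv g z * v))) (at z)"
    by (intro has_derivative_add has_derivative_cnj)
  then show ?thesis
    by (rule has_derivative_transform_within_open[OF _ \<open>open S\<close> z]) (simp add: f)
qed

lemma pd_harmonic:
  assumes "open S" "h holomorphic_on S" "g holomorphic_on S"
    and "\<And>z. z \<in> S \<Longrightarrow> f z = h z + cnj (g z)" and "z \<in> S"
  shows "pd v f z = v * deriv h z + cnj (v * deriv g z)"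
  using frechet_derivative_at[OF has_derivative_harmonic[OF assms], symmetric]
  by (simp add: pd_def mult.commute[of v])

lemma C1_on_harmonic:
  assumes "open S" "h holomorphic_on S" "g holomorphic_on S"
    and "\<And>z. z \<in> S \<Longrightarrow> f z = h z + cnj (g z)"
  shows "C1_on S f"
  unfolding C1_on_def
proof (intro conjI ballI allI)
  show "f differentiable (at z)" if "z \<in> S" for z
    using has_derivative_harmonic[OF assms that] by (auto simp: differentiable_def)
  have "continuous_on S (\<lambda>z. v * deriv h z + cnj (v * deriv g z))" for v
    using assms by (intro continuous_intros holomorphic_on_imp_continuous_on holomorphic_deriv) auto
  then show "continuous_on S (pd v f)" for v
    by (subst continuous_on_cong[OF refl pd_harmonic[OF assms]])
qed

lemma harmonic_on_holomorphic_add_cnj: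
  assumes "open S" "h holomorphic_on S" "g holomorphic_on S"
    and "\<And>z. z \<in> S \<Longrightarrow> f z = h z + cnj (g z)"
  shows "harmonic_on S f"
proof -
  have H: "(\<lambda>z. v * deriv h z) holomorphic_on S" "(\<lambda>z. v * deriv g z) holomorphic_on S" for v
    using assms by (auto intro!: holomorphic_intros)
  note P = H pd_harmonic[OF assms]
  have "pd v (pd v f) z = v\<^sup>2 * deriv (deriv h) z + cnj (v\<^sup>2 * deriv (deriv g) z)"
    if z: "z \<in> S" for v z
  proof -
    have "deriv h field_differentiable (at z)" "deriv g field_differentiable (at z)"
      using assms z by (auto intro: holomorphic_on_imp_differentiable_at holomorphic_deriv)
    then show ?thesis
      using pd_harmonic[OF assms(1) P z] by (simp add: power2_eq_square mult.assoc)
  qed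
  then show ?thesis
    using C1_on_harmonic[OF assms] C1_on_harmonic[OF assms(1) P]
    by (simp add: harmonic_on_def laplacian_def)
qed

lemma wirtinger_harmonic:
  assumes "open S" "h holomorphic_on S" "g holomorphic_on S"
    and "\<And>z. z \<in> S \<Longrightarrow> f z = h z + cnj (g z)" and "z \<in> S"
  shows "dz f z = deriv h z" "dzbar f z = cnj (deriv g z)"
    "jacobian f z = (norm (deriv h z))\<^sup>2 - (norm (deriv g z))\<^sup>2"
proof -
  show D: "dz f z = deriv h z" "dzbar f z = cnj (deriv g z)"
    by (simp_all add: dz_def dzbar_def pd_harmonic[OF assms] algebra_simps)
  show "jacobian f z = (norm (deriv h z))\<^sup>2 - (norm (deriv g z))\<^sup>2"
    by (simp add: jacobian_def D)
qed

end

theory Submission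
  imports Defs
begin

text \<open>
  Write \<open>H\<close> for the supremum norm of \<open>h\<close>, \<open>A = \<bar>a\<^sub>0\<bar>\<close> and \<open>k = (K - 1) / (K + 1)\<close>.

  For the inequality, a bounded analytic function satisfies \<open>\<bar>a\<^sub>n\<bar> \<le> W\<close> for \<open>n \<ge> 1\<close>, where
  \<open>W = (H\<^sup>2 - A\<^sup>2) / H\<close> (\<open>bounded_coeff_bound\<close>), so that the analytic part contributes at most
  \<open>A + W r / (1 - r)\<close>.  The dilatation \<open>g' / h'\<close> is bounded by \<open>k\<close> and vanishes at \<open>0\<close>, whence
  \<open>\<bar>g'(z)\<bar> \<le> k \<bar>z\<bar> \<bar>h'(z)\<bar>\<close> by the Schwarz lemma.  On the circle of radius \<open>r\<close>, Parseval's identity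
  turns this pointwise bound into one between the square sums of the coefficients \<open>n b\<^sub>n\<close> and
  \<open>n a\<^sub>n\<close>, and the Cauchy-Schwarz inequality against \<open>1 / n\<close>, \<open>n \<ge> 2\<close>, recovers the sum of
  \<open>\<bar>b\<^sub>n\<bar> r\<^sup>n\<close> (\<open>suminf_coanalytic_le\<close>); the factor \<open>\<pi>\<^sup>2 / 6 - 1\<close> is the sum of \<open>1 / n\<^sup>2\<close> over
  \<open>n \<ge> 2\<close>.  Together the Bohr sum is at most \<open>A + W M\<^sub>K(r)\<close>.  As \<open>M\<^sub>K\<close> increases, this is at most
  \<open>A + (H\<^sup>2 - A\<^sup>2) / (2 H)\<close> up to \<open>r\<^sub>K\<close>, and that is at most \<open>H\<close> because \<open>(H - A)\<^sup>2 \<ge> 0\<close>.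

  For the sharpness, let \<open>0 < a < 1\<close>, take the disk involution \<open>h(z) = (a - z) / (1 - a z)\<close> and choose \<open>g\<close>
  with \<open>g'(z) = k z h'(z)\<close>.  The Bohr sum minus \<open>1\<close> is \<open>1 - a\<close> times a quantity whose limit as
  \<open>a \<rightarrow> 1\<close> is the left-hand side of the equation for \<open>R\<close>, minus \<open>1\<close>; that left-hand side is strictly
  increasing, so it exceeds \<open>1\<close> beyond \<open>R\<close>, and there \<open>a\<close> close to \<open>1\<close> violates the inequality.
  What needs proof is that \<open>f = h + cnj g\<close> is quasiconformal
  (\<open>quasiconformal_harmonic_convex\<close>).  Since \<open>h\<close> maps onto a convex set, \<open>g\<close> is a
  function of \<open>h\<close> with Lipschitz constant \<open>k < 1\<close>, which makes \<open>f\<close> injective; invariance of domain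
  makes it a homeomorphism onto a domain; and the weak derivatives of the smooth map \<open>f\<close> are its
  classical ones, by integration by parts.
\<close>

section \<open>Parseval's identity on circles\<close>

lemma has_integral_cis_period:
  fixes k :: int
  shows "((\<lambda>t. cis (2 * pi * of_int k * t)) has_integral (if k = 0 then 1 else 0)) {0..1}"
proof (cases "k = 0")
  case True
  then show ?thesis using has_integral_const_real[of "1::complex" 0 1] by simp
next
  case False
  define w where "w = 2 * pi * of_int k"
  have "w \<noteq> 0" using False by (simp add: w_def)
  have "((\<lambda>t. cis (w * t)) has_integral (cis (w * 1) / (\<i> * w) - cis (w * 0) / (\<i> * w))) {0..1}"
  proof (rule fundamental_theorem_of_calculus)
    fix t :: real
    have "((\<lambda>z. exp (\<i> * w * z) / (\<i> * w)) has_field_derivative exp (\<i> * w * of_real t)) (at (of_real t))"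
      using \<open>w \<noteq> 0\<close> by (auto intro!: derivative_eq_intros)
    from has_vector_derivative_real_field[OF this]
    show "((\<lambda>t. cis (w * t) / (\<i> * w)) has_vector_derivative cis (w * t)) (at t within {0..1})"
      by (auto simp: cis_conv_exp mult.assoc intro: has_vector_derivative_at_within)
  qed simp
  moreover have "cis w = 1"
    using cis_multiple_2pi[of "of_int k"] by (simp add: w_def mult.assoc)
  ultimately show ?thesis
    using False by (simp add: w_def)
qed

lemma norm_sum_power2_complex:
  fixes w :: "'a \<Rightarrow> complex"
  shows "of_real ((norm (\<Sum>i\<in>A. w i))\<^sup>2) = (\<Sum>i\<in>A. \<Sum>j\<in>A. w i * cnj (w j))"
  using complex_norm_square[of "sum w A"] by (simp add: sum_product)

text \<open>The exponentials are orthonormal on \<open>[0, 1]\<close>, so only the diagonal terms of the expanded square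
  survive integration.\<close>

lemma has_integral_norm_power2_trig_poly:
  fixes w :: "nat \<Rightarrow> complex"
  shows "((\<lambda>t. (norm (\<Sum>n<N. w n * cis (2 * pi * t) ^ n))\<^sup>2) has_integral
    (\<Sum>n<N. (norm (w n))\<^sup>2)) {0..1}"
proof -
  have cis: "cis (2 * pi * t) ^ n * cnj (cis (2 * pi * t) ^ m) = cis (2 * pi * of_int (int n - int m) * t)"
    for n m :: nat and t :: real
  proof -
    have "cis (2 * pi * t) ^ n * cnj (cis (2 * pi * t) ^ m) =
        cis (real n * (2 * pi * t)) * cis (- (real m * (2 * pi * t)))"
      by (simp only: Complex.DeMoivre cis_cnj)
    also have "\<dots> = cis (real n * (2 * pi * t) + - (real m * (2 * pi * t)))"
      by (rule cis_mult)
    also have "real n * (2 * pi * t) + - (real m * (2 * pi * t)) = 2 * pi * of_int (int n - int m) * t"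
      by (simp add: algebra_simps)
    finally show ?thesis .
  qed
  have "((\<lambda>t. \<Sum>n<N. \<Sum>m<N. w n * cnj (w m) * cis (2 * pi * of_int (int n - int m) * t)) has_integral
    (\<Sum>n<N. \<Sum>m<N. w n * cnj (w m) * (if int n - int m = 0 then 1 else 0))) {0..1}"
    by (intro has_integral_sum has_integral_mult_right has_integral_cis_period) auto
  also have "(\<lambda>t. \<Sum>n<N. \<Sum>m<N. w n * cnj (w m) * cis (2 * pi * of_int (int n - int m) * t)) =
      (\<lambda>t. of_real ((norm (\<Sum>n<N. w n * cis (2 * pi * t) ^ n))\<^sup>2))"
    unfolding norm_sum_power2_complex cis[symmetric] by (simp add: mult_ac)
  also have "(\<Sum>n<N. \<Sum>m<N. w n * cnj (w m) * (if int n - int m = 0 then 1 else 0)) =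
      (\<Sum>n<N. w n * cnj (w n))"
    by (simp add: if_distrib cong: if_cong)
  also have "\<dots> = of_real (\<Sum>n<N. (norm (w n))\<^sup>2)"
    by (simp only: complex_norm_square of_real_sum)
  finally have "((\<lambda>t. complex_of_real ((norm (\<Sum>n<N. w n * cis (2 * pi * t) ^ n))\<^sup>2)) has_integral
      complex_of_real (\<Sum>n<N. (norm (w n))\<^sup>2)) {0..1}" .
  from has_integral_linear[OF this bounded_linear_Re] show ?thesis
    by (simp only: o_def Re_complex_of_real)
qed

text \<open>Inside the disk of convergence the partial sums converge uniformly on a circle, so the
  identity for trigonometric polynomials passes to the limit.\<close>

lemma Parseval_circle:
  fixes c :: "nat \<Rightarrow> complex"
  assumes c: "\<And>z. norm z < R \<Longrightarrow> (\<lambda>n. c n * z ^ n) sums F z" and \<rho>: "0 \<le> \<rho>" "\<rho> < R"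
  obtains I where "((\<lambda>t. (norm (F (of_real \<rho> * cis (2 * pi * t))))\<^sup>2) has_integral I) {0..1}"
    and "(\<lambda>n. (norm (c n))\<^sup>2 * \<rho> ^ (2 * n)) sums I"
proof -
  define w where "w n = c n * of_real \<rho> ^ n" for n
  obtain r where r: "\<rho> < r" "r < R" using \<rho> dense by blast
  have "summable (\<lambda>n. norm (w n))"
    unfolding w_def
    using powser_insidea[of c "of_real r" "of_real \<rho>"] c[of "of_real r"] r \<rho> sums_summable by force
  then have sumw: "summable (\<lambda>n. norm (w n))" .
  have ul: "uniform_limit {0..1} (\<lambda>N t. \<Sum>n<N. w n * cis (2 * pi * t) ^ n)
      (\<lambda>t. \<Sum>n. w n * cis (2 * pi * t) ^ n) sequentially"
    by (rule Weierstrass_m_test[OF _ sumw]) (simp add: norm_mult norm_power)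
  have "(\<Sum>n. w n * cis (2 * pi * t) ^ n) = F (of_real \<rho> * cis (2 * pi * t))" for t
    using c[of "of_real \<rho> * cis (2 * pi * t)"] \<rho>
    by (simp add: w_def sums_iff norm_mult power_mult_distrib mult_ac)
  then have ul: "uniform_limit {0..1} (\<lambda>N t. \<Sum>n<N. w n * cis (2 * pi * t) ^ n)
      (\<lambda>t. F (of_real \<rho> * cis (2 * pi * t))) sequentially"
    using ul by simp
  have cont: "continuous_on {0..1::real} (\<lambda>t. \<Sum>n<N. w n * cis (2 * pi * t) ^ n)" for N
    by (intro continuous_intros)
  have contF: "continuous_on {0..1::real} (\<lambda>t. F (of_real \<rho> * cis (2 * pi * t)))"
    by (rule uniform_limit_theorem[OF _ ul]) (use cont in auto)
  have bd: "bounded ((\<lambda>t. F (of_real \<rho> * cis (2 * pi * t))) ` {0..1::real})"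
    by (intro compact_imp_bounded compact_continuous_image contF) auto
  have "uniform_limit {0..1} (\<lambda>N t. norm (\<Sum>n<N. w n * cis (2 * pi * t) ^ n))
      (\<lambda>t. norm (F (of_real \<rho> * cis (2 * pi * t)))) sequentially"
    by (rule uniform_limit_intros ul)+
  then have "uniform_limit {0..1} (\<lambda>N t. (norm (\<Sum>n<N. w n * cis (2 * pi * t) ^ n))\<^sup>2)
      (\<lambda>t. (norm (F (of_real \<rho> * cis (2 * pi * t))))\<^sup>2) sequentially"
    unfolding power2_eq_square using bd
    by (intro uniform_lim_mult) (auto simp: bounded_iff)
  then obtain I J where I: "\<And>N. ((\<lambda>t. (norm (\<Sum>n<N. w n * cis (2 * pi * t) ^ n))\<^sup>2) has_integral I N) {0..1}"
    and J: "((\<lambda>t. (norm (F (of_real \<rho> * cis (2 * pi * t))))\<^sup>2) has_integral J) {0..1}" and IJ: "I \<longlonglongrightarrow> J"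
    by (rule uniform_limit_integral) (intro continuous_intros | force)+
  have "I = (\<lambda>N. \<Sum>n<N. (norm (w n))\<^sup>2)"
    using I has_integral_norm_power2_trig_poly has_integral_unique by blast
  then have "(\<lambda>n. (norm (w n))\<^sup>2) sums J"
    using IJ by (simp add: sums_def)
  moreover have "(norm (w n))\<^sup>2 = (norm (c n))\<^sup>2 * \<rho> ^ (2 * n)" for n
    using \<rho> by (simp add: w_def norm_mult norm_power power_mult_distrib power_mult[symmetric] mult.commute)
  ultimately show ?thesis using that J by simp
qed

text \<open>Both square sums are mean squares over the circle of radius \<open>\<rho>\<close>, where \<open>F\<close> is dominated
  pointwise by \<open>B G\<close>.\<close>

lemma square_sum_coeffs_le:
  fixes c d :: "nat \<Rightarrow> complex"
  assumes c: "\<And>z. norm z < R \<Longrightarrow> (\<lambda>n. c n * z ^ n) sums F z"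
    and d: "\<And>z. norm z < R \<Longrightarrow> (\<lambda>n. d n * z ^ n) sums G z"
    and le: "\<And>z. norm z = \<rho> \<Longrightarrow> norm (F z) \<le> B * norm (G z)"
    and \<rho>: "0 \<le> \<rho>" "\<rho> < R"
  shows "summable (\<lambda>n. (norm (c n))\<^sup>2 * \<rho> ^ (2 * n))"
    and "summable (\<lambda>n. (norm (d n))\<^sup>2 * \<rho> ^ (2 * n))"
    and "(\<Sum>n. (norm (c n))\<^sup>2 * \<rho> ^ (2 * n)) \<le> B\<^sup>2 * (\<Sum>n. (norm (d n))\<^sup>2 * \<rho> ^ (2 * n))"
proof -
  obtain I where I: "((\<lambda>t. (norm (F (of_real \<rho> * cis (2 * pi * t))))\<^sup>2) has_integral I) {0..1}"
    "(\<lambda>n. (norm (c n))\<^sup>2 * \<rho> ^ (2 * n)) sums I"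
    using Parseval_circle[OF c \<rho>] .
  obtain J where J: "((\<lambda>t. (norm (G (of_real \<rho> * cis (2 * pi * t))))\<^sup>2) has_integral J) {0..1}"
    "(\<lambda>n. (norm (d n))\<^sup>2 * \<rho> ^ (2 * n)) sums J"
    using Parseval_circle[OF d \<rho>] .
  have "I \<le> B\<^sup>2 * J"
  proof (rule has_integral_le[OF I(1) has_integral_mult_right[OF J(1)]])
    fix t :: real
    have "norm (F (of_real \<rho> * cis (2 * pi * t))) \<le> B * norm (G (of_real \<rho> * cis (2 * pi * t)))"
      using le \<rho> by (simp add: norm_mult)
    from power_mono[OF this, of 2]
    show "(norm (F (of_real \<rho> * cis (2 * pi * t))))\<^sup>2 \<le> B\<^sup>2 * (norm (G (of_real \<rho> * cis (2 * pi * t))))\<^sup>2"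
      by (simp add: power_mult_distrib)
  qed
  then show "summable (\<lambda>n. (norm (c n))\<^sup>2 * \<rho> ^ (2 * n))"
    "summable (\<lambda>n. (norm (d n))\<^sup>2 * \<rho> ^ (2 * n))"
    "(\<Sum>n. (norm (c n))\<^sup>2 * \<rho> ^ (2 * n)) \<le> B\<^sup>2 * (\<Sum>n. (norm (d n))\<^sup>2 * \<rho> ^ (2 * n))"
    using I J by (auto simp: sums_iff)
qed

section \<open>Coefficients of bounded analytic functions\<close>

text \<open>The hypothesis says that the matrix with rows \<open>(A, 0)\<close> and \<open>(x, A)\<close> does not stretch the vectors
  \<open>(1, t)\<close> by more than \<open>H\<close>.  The best choice \<open>t = x A / (H\<^sup>2 - A\<^sup>2)\<close> gives \<open>x H \<le> H\<^sup>2 - A\<^sup>2\<close>.\<close>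

lemma lower_triangular_contraction:
  fixes A x H :: real
  assumes "0 \<le> A" "0 \<le> x" "0 < H" and *: "\<And>t. t \<ge> 0 \<Longrightarrow> A\<^sup>2 + (x + t * A)\<^sup>2 \<le> H\<^sup>2 * (1 + t\<^sup>2)"
  shows "x \<le> (H\<^sup>2 - A\<^sup>2) / H"
proof -
  have "A\<^sup>2 + x\<^sup>2 \<le> H\<^sup>2" using *[of 0] by simp
  define d where "d = H\<^sup>2 - A\<^sup>2"
  have d: "x\<^sup>2 \<le> d" using \<open>A\<^sup>2 + x\<^sup>2 \<le> H\<^sup>2\<close> by (simp add: d_def)
  show ?thesis
  proof (cases "d = 0")
    case True
    then show ?thesis using d assms by (simp add: d_def)
  next
    case False
    then have "d > 0" using d zero_le_power2[of x] by linarith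
    define t where "t = x * A / d"
    have t: "t \<ge> 0" "t * d = x * A" using \<open>d > 0\<close> assms(1,2) by (auto simp: t_def)
    have "x\<^sup>2 + 2 * x * A * t \<le> d + d * t\<^sup>2"
      using *[OF t(1)] by (simp add: d_def power2_eq_square algebra_simps)
    from mult_right_mono[OF this less_imp_le[OF \<open>d > 0\<close>]]
    have "x\<^sup>2 * d + 2 * x * A * (t * d) \<le> d\<^sup>2 + (t * d)\<^sup>2"
      by (simp add: power2_eq_square algebra_simps)
    then have "x\<^sup>2 * d + x\<^sup>2 * A\<^sup>2 \<le> d\<^sup>2"
      unfolding t(2) by (simp add: power2_eq_square algebra_simps)
    then have "(x * H)\<^sup>2 \<le> d\<^sup>2"
      by (simp add: d_def power2_eq_square algebra_simps)
    then have "x * H \<le> d"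
      using \<open>d > 0\<close> power2_le_imp_le by fastforce
    then show ?thesis using \<open>H > 0\<close> by (simp add: d_def field_simps)
  qed
qed

lemma exists_aligning_rotation:
  fixes p q :: complex
  obtains \<sigma> where "norm \<sigma> = 1" "\<And>t. t \<ge> 0 \<Longrightarrow> norm (p + of_real t * \<sigma> * q) = norm p + t * norm q"
proof
  let ?\<sigma> = "cis (Arg p - Arg q)"
  show "norm ?\<sigma> = 1" by simp
  fix t :: real assume "t \<ge> 0"
  have p: "p = of_real (norm p) * cis (Arg p)" and q: "q = of_real (norm q) * cis (Arg q)"
    using rcis_cmod_Arg[of p] rcis_cmod_Arg[of q] by (simp_all add: rcis_def)
  have "p + of_real t * ?\<sigma> * q = of_real (norm p) * cis (Arg p) + of_real t * (of_real (norm q) * (?\<sigma> * cis (Arg q)))"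
    by (subst p, subst (2) q) (simp add: mult_ac)
  also have "\<dots> = of_real (norm p + t * norm q) * cis (Arg p)"
    by (simp add: cis_mult algebra_simps)
  finally show "norm (p + of_real t * ?\<sigma> * q) = norm p + t * norm q"
    using \<open>t \<ge> 0\<close> by (simp add: norm_mult del: of_real_add)
qed

text \<open>Multiplication by \<open>h\<close> enlarges mean squares over circles by a factor of at most \<open>H\<^sup>2\<close>.  Apply this
  to \<open>1 + \<beta> z\<^sup>m\<close> and keep only the coefficients at \<open>0\<close> and \<open>m\<close> of the product: these are \<open>a\<^sub>0\<close> and
  \<open>a\<^sub>m + \<beta> a\<^sub>0\<close>, which leads to the two-by-two matrix above.  The argument works on each circle of
  radius \<open>\<rho> < 1\<close>, and \<open>\<rho>\<close> tends to \<open>1\<close> at the end.\<close>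

lemma bounded_coeff_bound:
  fixes a :: "nat \<Rightarrow> complex"
  assumes a: "\<And>z. norm z < 1 \<Longrightarrow> (\<lambda>n. a n * z ^ n) sums h z"
    and H: "\<And>z. norm z < 1 \<Longrightarrow> norm (h z) \<le> H" "H > 0" and m: "m \<ge> 1"
  shows "norm (a m) \<le> (H\<^sup>2 - (norm (a 0))\<^sup>2) / H"
proof -
  have key: "norm (a m) * \<rho> ^ m \<le> (H\<^sup>2 - (norm (a 0))\<^sup>2) / H" if \<rho>: "0 < \<rho>" "\<rho> < 1" for \<rho>
  proof (rule lower_triangular_contraction)
    fix t :: real assume t: "t \<ge> 0"
    obtain \<sigma> where \<sigma>: "norm \<sigma> = 1"
      "norm (a m * of_real \<rho> ^ m + of_real t * \<sigma> * a 0) = norm (a m * of_real \<rho> ^ m) + t * norm (a 0)"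
      using exists_aligning_rotation t by metis
    \<comment> \<open>The modulus of \<open>\<beta>\<close> is chosen such that \<open>\<bar>\<beta>\<bar> \<rho>\<^sup>m = t\<close>, its argument such that \<open>a\<^sub>m\<close> and
      \<open>\<beta> a\<^sub>0\<close> are aligned.\<close>
    define \<beta> where "\<beta> = of_real t * \<sigma> / of_real \<rho> ^ m"
    have \<beta>: "\<beta> * of_real \<rho> ^ m = of_real t * \<sigma>" using \<rho> by (simp add: \<beta>_def)
    have n\<beta>: "norm \<beta> * \<rho> ^ m = t"
      using arg_cong[OF \<beta>, of norm] \<rho> t \<sigma>(1) by (simp add: norm_mult norm_power)
    define d where "d n = (if n = 0 then 1 else if n = m then \<beta> else 0)" for n
    define c where "c n = a n + (if n < m then 0 else \<beta> * a (n - m))" for n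
    have d: "(\<lambda>n. d n * z ^ n) sums (1 + \<beta> * z ^ m)" for z
      using sums_finite[of "{0, m}" "\<lambda>n. d n * z ^ n"] m by (auto simp: d_def)
    have c: "(\<lambda>n. c n * z ^ n) sums (h z * (1 + \<beta> * z ^ m))" if "norm z < 1" for z
    proof -
      have "(\<lambda>n. (\<beta> * z ^ m) * (a n * z ^ n)) sums ((\<beta> * z ^ m) * h z)"
        by (intro sums_mult a that)
      then have "(\<lambda>n. (if n + m < m then 0 else \<beta> * a (n + m - m)) * z ^ (n + m)) sums ((\<beta> * z ^ m) * h z)"
        by (simp add: power_add mult_ac)
      then have "(\<lambda>n. (if n < m then 0 else \<beta> * a (n - m)) * z ^ n) sums ((\<beta> * z ^ m) * h z)"
        by (subst (asm) sums_zero_iff_shift) auto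
      from sums_add[OF a[OF that] this] show ?thesis
        by (simp add: c_def algebra_simps)
    qed
    have le: "norm (h z * (1 + \<beta> * z ^ m)) \<le> H * norm (1 + \<beta> * z ^ m)" if "norm z = \<rho>" for z
      unfolding norm_mult using H that \<rho> by (intro mult_right_mono) auto
    have sq: "summable (\<lambda>n. (norm (c n))\<^sup>2 * \<rho> ^ (2 * n))"
      "(\<Sum>n. (norm (c n))\<^sup>2 * \<rho> ^ (2 * n)) \<le> H\<^sup>2 * (\<Sum>n. (norm (d n))\<^sup>2 * \<rho> ^ (2 * n))"
      using square_sum_coeffs_le(1,3)[of 1 c _ d _ \<rho> H, OF c d le] \<rho> by simp_all
    have "(\<Sum>n. (norm (d n))\<^sup>2 * \<rho> ^ (2 * n)) = (\<Sum>n\<in>{0, m}. (norm (d n))\<^sup>2 * \<rho> ^ (2 * n))"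
      by (rule suminf_finite) (auto simp: d_def)
    also have "\<dots> = 1 + (norm \<beta> * \<rho> ^ m)\<^sup>2"
      using m by (simp add: d_def power_mult_distrib power_mult[symmetric] mult.commute)
    finally have D: "(\<Sum>n. (norm (d n))\<^sup>2 * \<rho> ^ (2 * n)) = 1 + t\<^sup>2" by (simp add: n\<beta>)
    have "c m * of_real \<rho> ^ m = a m * of_real \<rho> ^ m + of_real t * \<sigma> * a 0"
      unfolding \<beta>[symmetric] by (simp add: c_def algebra_simps)
    from arg_cong[OF this, of norm] have cm: "norm (c m) * \<rho> ^ m = norm (a m) * \<rho> ^ m + t * norm (a 0)"
      using \<sigma>(2) \<rho> by (simp add: norm_mult norm_power)
    have "(norm (a 0))\<^sup>2 + (norm (c m) * \<rho> ^ m)\<^sup>2 = (\<Sum>n\<in>{0, m}. (norm (c n))\<^sup>2 * \<rho> ^ (2 * n))"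
      using m by (simp add: c_def power_mult_distrib power_mult[symmetric] mult.commute)
    also have "\<dots> \<le> (\<Sum>n. (norm (c n))\<^sup>2 * \<rho> ^ (2 * n))"
      using sq(1) \<rho> by (intro sum_le_suminf) auto
    also have "\<dots> \<le> H\<^sup>2 * (1 + t\<^sup>2)"
      using sq(2) D by simp
    finally show "(norm (a 0))\<^sup>2 + (norm (a m) * \<rho> ^ m + t * norm (a 0))\<^sup>2 \<le> H\<^sup>2 * (1 + t\<^sup>2)"
      by (simp add: cm)
  qed (use H \<rho> in auto)
  have "((\<lambda>\<rho>. norm (a m) * \<rho> ^ m) \<longlongrightarrow> norm (a m) * 1 ^ m) (at_left 1)"
    by (intro tendsto_intros)
  moreover have "\<forall>\<^sub>F \<rho> in at_left 1. norm (a m) * \<rho> ^ m \<le> (H\<^sup>2 - (norm (a 0))\<^sup>2) / H"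
    using eventually_at_left_real[OF zero_less_one] by eventually_elim (use key in auto)
  ultimately show ?thesis
    using tendsto_upperbound[of "\<lambda>\<rho>. norm (a m) * \<rho> ^ m" "norm (a m)" "at_left 1"] by simp
qed

section \<open>Coefficients of the derivative\<close>

lemma Cauchy_Schwarz_suminf:
  fixes p q :: "nat \<Rightarrow> real"
  assumes "\<And>n. p n \<ge> 0" "\<And>n. q n \<ge> 0"
    and p: "summable (\<lambda>n. (p n)\<^sup>2)" and q: "summable (\<lambda>n. (q n)\<^sup>2)"
  shows "summable (\<lambda>n. p n * q n)"
    and "(\<Sum>n. p n * q n) \<le> sqrt (\<Sum>n. (p n)\<^sup>2) * sqrt (\<Sum>n. (q n)\<^sup>2)"
proof -
  have *: "(\<Sum>n<N. p n * q n) \<le> sqrt (\<Sum>n. (p n)\<^sup>2) * sqrt (\<Sum>n. (q n)\<^sup>2)" for N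
  proof -
    have "(\<Sum>n<N. p n * q n) \<le> L2_set p {..<N} * L2_set q {..<N}"
      using L2_set_mult_ineq[of p q "{..<N}"] assms(1,2) by simp
    also have "\<dots> \<le> sqrt (\<Sum>n. (p n)\<^sup>2) * sqrt (\<Sum>n. (q n)\<^sup>2)"
      unfolding L2_set_def using p q
      by (intro mult_mono real_sqrt_le_mono sum_le_suminf) (auto intro: suminf_nonneg sum_nonneg)
    finally show ?thesis .
  qed
  show "summable (\<lambda>n. p n * q n)"
    using * assms(1,2) by (intro summableI_nonneg_bounded) auto
  then show "(\<Sum>n. p n * q n) \<le> sqrt (\<Sum>n. (p n)\<^sup>2) * sqrt (\<Sum>n. (q n)\<^sup>2)"
    using * by (rule suminf_le_const)
qed

text \<open>Multiplying the derivative by \<open>z\<close> restores the exponents, so that coefficients are compared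
  without an index shift.\<close>

lemma sums_times_deriv:
  fixes c :: "nat \<Rightarrow> 'a::{real_normed_field,banach}"
  assumes c: "\<And>z. norm z < R \<Longrightarrow> (\<lambda>n. c n * z ^ n) sums F z"
    and d: "(F has_field_derivative F') (at z)" and z: "norm z < R"
  shows "(\<lambda>n. of_nat n * c n * z ^ n) sums (z * F')"
proof -
  have "(\<lambda>n. diffs c n * z ^ n) sums F'"
    by (rule termdiffs_sums_strong[OF c d z])
  then have "(\<lambda>n. z * (diffs c n * z ^ n)) sums (z * F')"
    by (rule sums_mult)
  then have "(\<lambda>n. of_nat (Suc n) * c (Suc n) * z ^ Suc n) sums (z * F')"
    by (simp add: diffs_def mult_ac)
  then show ?thesis
    by (subst (asm) sums_Suc_iff) simp
qed

lemma sums_nat_times_power: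
  fixes x :: "'a::{real_normed_field,banach}"
  assumes "norm x < 1"
  shows "(\<lambda>n. of_nat n * x ^ n) sums (x / (1 - x)\<^sup>2)"
proof -
  have "x \<noteq> 1" using assms by auto
  then have "((\<lambda>x. 1 / (1 - x)) has_field_derivative (1 / (1 - x)\<^sup>2)) (at x)"
    by (auto intro!: derivative_eq_intros simp: power2_eq_square)
  from sums_times_deriv[of 1 "\<lambda>_. 1", OF _ this assms] show ?thesis
    by (simp add: geometric_sums)
qed

lemma sums_nat_power2_times_power:
  fixes x :: "'a::{real_normed_field,banach}"
  assumes "norm x < 1"
  shows "(\<lambda>n. (of_nat n)\<^sup>2 * x ^ n) sums (x * (1 + x) / (1 - x) ^ 3)"
proof -
  have "x \<noteq> 1" using assms by auto
  then have "((\<lambda>x. x / (1 - x)\<^sup>2) has_field_derivative ((1 + x) / (1 - x) ^ 3)) (at x)"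
    by (auto intro!: derivative_eq_intros simp: divide_simps) (simp add: eval_nat_numeral algebra_simps)
  then have "(\<lambda>n. of_nat n * of_nat n * x ^ n) sums (x * ((1 + x) / (1 - x) ^ 3))"
    using assms by (intro sums_times_deriv[OF sums_nat_times_power])
  then show ?thesis by (simp add: power2_eq_square)
qed

lemma sums_inverse_squares_from_2:
  "(\<lambda>n. (1 / real (n + 2))\<^sup>2) sums (pi\<^sup>2 / 6 - 1)"
proof -
  have "(\<lambda>n. 1 / (real n + 1)\<^sup>2) sums (pi\<^sup>2 / 6)"
    using inverse_squares_sums by (simp add: add.commute)
  then have "(\<lambda>n. 1 / (real (Suc n) + 1)\<^sup>2) sums (pi\<^sup>2 / 6 - 1)"
    by (subst sums_Suc_iff) simp
  then show ?thesis by (simp add: power_divide add_ac)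
qed

lemma pi_power2_div_6_ge_1: "0 \<le> pi\<^sup>2 / 6 - 1"
  using sums_le[OF _ sums_zero sums_inverse_squares_from_2] by simp

text \<open>Cauchy-Schwarz for the factorization of \<open>\<bar>b\<^sub>n\<bar> r\<^sup>n\<close> into \<open>n \<bar>b\<^sub>n\<bar> r\<^sup>n\<close> and \<open>1 / n\<close>.\<close>

lemma suminf_le_l2_derivative:
  fixes b :: "nat \<Rightarrow> complex"
  assumes r: "r \<ge> 0" and s: "summable (\<lambda>n. (real n * norm (b n))\<^sup>2 * r ^ (2 * n))"
  shows "summable (\<lambda>n. norm (b (n + 2)) * r ^ (n + 2))"
    and "(\<Sum>n. norm (b (n + 2)) * r ^ (n + 2)) \<le>
      sqrt (\<Sum>n. (real n * norm (b n))\<^sup>2 * r ^ (2 * n)) * sqrt (pi\<^sup>2 / 6 - 1)"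
proof -
  define p where "p n = real (n + 2) * norm (b (n + 2)) * r ^ (n + 2)" for n
  define q where "q n = 1 / real (n + 2)" for n
  have pq: "p n * q n = norm (b (n + 2)) * r ^ (n + 2)" for n
    by (simp add: p_def q_def del: of_nat_add)
  have p2: "(p n)\<^sup>2 = (real (n + 2) * norm (b (n + 2)))\<^sup>2 * r ^ (2 * (n + 2))" for n
    by (simp only: p_def power_mult_distrib power_mult[symmetric] mult.commute[of 2])
  have sp: "summable (\<lambda>n. (p n)\<^sup>2)"
    unfolding p2 using s by (subst summable_iff_shift)
  have nonneg: "p n \<ge> 0" "q n \<ge> 0" for n using r by (auto simp: p_def q_def)
  have q: "(\<lambda>n. (q n)\<^sup>2) sums (pi\<^sup>2 / 6 - 1)"
    unfolding q_def by (rule sums_inverse_squares_from_2)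
  note CS = Cauchy_Schwarz_suminf[of p q, OF nonneg sp sums_summable[OF q]]
  show "summable (\<lambda>n. norm (b (n + 2)) * r ^ (n + 2))"
    using CS(1) by (simp add: pq)
  have "(\<Sum>n. norm (b (n + 2)) * r ^ (n + 2)) \<le> sqrt (\<Sum>n. (p n)\<^sup>2) * sqrt (pi\<^sup>2 / 6 - 1)"
    using CS(2) q by (simp add: pq sums_iff)
  also have "(\<Sum>n. (p n)\<^sup>2) \<le> (\<Sum>n. (real n * norm (b n))\<^sup>2 * r ^ (2 * n))"
    unfolding p2 using suminf_split_initial_segment[OF s, of 2] r by (simp add: sum_nonneg)
  finally show "(\<Sum>n. norm (b (n + 2)) * r ^ (n + 2)) \<le>
      sqrt (\<Sum>n. (real n * norm (b n))\<^sup>2 * r ^ (2 * n)) * sqrt (pi\<^sup>2 / 6 - 1)"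
    using pi_power2_div_6_ge_1 by (simp add: mult_right_mono)
qed

section \<open>The equations for the radii\<close>

lemma strict_mono_on_M:
  assumes "K \<ge> 1" shows "strict_mono_on {0..<1} (M K)"
proof (rule strict_mono_onI)
  fix r s :: real assume r: "r \<in> {0..<1}" "s \<in> {0..<1}" "r < s"
  have "r / (1 - r) < s / (1 - s)"
    using r by (intro frac_less) auto
  moreover have "(K - 1) / (K + 1) * r\<^sup>2 * sqrt ((1 + r\<^sup>2) / (1 - r\<^sup>2) ^ 3) * sqrt (pi\<^sup>2 / 6 - 1) \<le>
     (K - 1) / (K + 1) * s\<^sup>2 * sqrt ((1 + s\<^sup>2) / (1 - s\<^sup>2) ^ 3) * sqrt (pi\<^sup>2 / 6 - 1)"
  proof -
    have rs: "r\<^sup>2 \<le> s\<^sup>2" "s\<^sup>2 < 1" using r by (auto intro: power_mono simp: power_less_one_iff)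
    then have r1: "r\<^sup>2 \<le> 1" by linarith
    moreover have "0 \<le> pi\<^sup>2 / 6 - 1" by (rule pi_power2_div_6_ge_1)
    ultimately show ?thesis using assms r rs r1
      by (intro mult_right_mono mult_mono real_sqrt_le_mono frac_le power_mono real_sqrt_ge_zero
        divide_nonneg_nonneg zero_le_power) auto
  qed
  ultimately show "M K r < M K s" by (simp add: M_def)
qed

lemma ex1_is_rK:
  assumes "K \<ge> 1" shows "\<exists>!r. is_rK K r"
proof (rule ex_ex1I)
  have "0 \<le> pi\<^sup>2 / 6 - 1" by (rule pi_power2_div_6_ge_1)
  moreover have "continuous_on {0..1/2} (M K)"
    unfolding M_def by (intro continuous_intros) (auto simp: power2_eq_1_iff)
  moreover have "M K 0 = 0" by (simp add: M_def)
  \<comment> \<open>The first summand of \<open>M K (1/2)\<close> alone is \<open>1\<close>.\<close>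
  moreover have "M K (1/2) \<ge> 1/2"
  proof -
    define X where "X = (K - 1) / (K + 1) * (1/2)\<^sup>2 * sqrt ((1 + (1/2)\<^sup>2) / (1 - (1/2)\<^sup>2) ^ 3) * sqrt (pi\<^sup>2 / 6 - 1)"
    have "0 \<le> X"
      unfolding X_def using assms \<open>0 \<le> pi\<^sup>2 / 6 - 1\<close>
      by (intro mult_nonneg_nonneg real_sqrt_ge_zero) (auto simp: power2_eq_square)
    moreover have "M K (1/2) = (1/2) / (1 - 1/2) + X" by (simp only: M_def X_def)
    ultimately show ?thesis by simp
  qed
  ultimately obtain r where "0 \<le> r" "r \<le> 1/2" "M K r = 1/2"
    using IVT'[of "M K" 0 "1/2" "1/2"] by auto
  then have "is_rK K r" using \<open>M K 0 = 0\<close> by (cases "r = 0") (auto simp: is_rK_def)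
  then show "\<exists>r. is_rK K r" ..
  fix r s assume "is_rK K r" "is_rK K s"
  then show "r = s"
    using strict_mono_on_eqD[OF strict_mono_on_M[OF assms], of r s] by (simp add: is_rK_def)
qed

text \<open>The derivative is positive because \<open>(K - 1) (1 - x) \<le> K - 1 < 2 K\<close>: the logarithm decreases
  more slowly than the rational part increases.\<close>

lemma strict_mono_on_R_equation:
  fixes K :: real
  assumes "K \<ge> 1"
  shows "strict_mono_on {0..<1} (\<lambda>R. 4 * R / (1 - R) * (K / (K + 1)) + 2 * ((K - 1) / (K + 1)) * ln (1 - R))"
proof (rule strict_mono_onI)
  fix r s :: real assume r: "r \<in> {0..<1}" "s \<in> {0..<1}" "r < s"
  let ?F = "\<lambda>R. 4 * R / (1 - R) * (K / (K + 1)) + 2 * ((K - 1) / (K + 1)) * ln (1 - R)"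
  show "?F r < ?F s"
  proof (rule DERIV_pos_imp_increasing[OF r(3)])
    fix x assume "r \<le> x" "x \<le> s"
    then have x: "0 \<le> x" "x < 1" using r by auto
    let ?D = "4 / (1 - x)\<^sup>2 * (K / (K + 1)) - 2 * ((K - 1) / (K + 1)) / (1 - x)"
    have "(?F has_real_derivative ?D) (at x)"
    proof -
      have "((\<lambda>R. R / (1 - R)) has_real_derivative 1 / (1 - x)\<^sup>2) (at x)"
        using x by (auto intro!: derivative_eq_intros simp: power2_eq_square)
      moreover have "((\<lambda>R. ln (1 - R)) has_real_derivative - 1 / (1 - x)) (at x)"
        using x by (auto intro!: derivative_eq_intros)
      ultimately have "((\<lambda>R. (4 * (K / (K + 1))) * (R / (1 - R)) + (2 * ((K - 1) / (K + 1))) * ln (1 - R))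
          has_real_derivative (4 * (K / (K + 1))) * (1 / (1 - x)\<^sup>2) + (2 * ((K - 1) / (K + 1))) * (- 1 / (1 - x))) (at x)"
        by (intro DERIV_add DERIV_cmult)
      then show ?thesis by (simp add: mult_ac)
    qed
    moreover have "?D > 0"
    proof -
      have "?D = (4 * K - 2 * ((K - 1) * (1 - x))) / ((1 - x)\<^sup>2 * (K + 1))"
        using x assms by (simp add: divide_simps) (simp add: power2_eq_square algebra_simps)
      moreover have "(K - 1) * (1 - x) \<le> K - 1"
        using x assms by (intro mult_right_le_one_le) auto
      then have "0 < 4 * K - 2 * ((K - 1) * (1 - x))" using assms by linarith
      ultimately show ?thesis using x assms by (metis divide_pos_pos mult_pos_pos add_pos_pos zero_less_power
        diff_gt_0_iff_gt less_le_trans zero_less_one)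
    qed
    ultimately show "\<exists>y. (?F has_real_derivative y) (at x) \<and> y > 0" by blast
  qed
qed

lemma ex1_is_R:
  assumes "K \<ge> 1" shows "\<exists>!R. is_R K R"
proof (rule ex_ex1I)
  let ?F = "\<lambda>R. 4 * R / (1 - R) * (K / (K + 1)) + 2 * ((K - 1) / (K + 1)) * ln (1 - R)"
  have "continuous_on {0..1/2} ?F"
    by (intro continuous_intros) auto
  moreover have "?F (1/2) \<ge> 1"
  proof -
    \<comment> \<open>With this bound the value at \<open>1/2\<close> is at least \<open>2\<close>.\<close>
    have "ln (1/2::real) \<ge> -1" using ln_le_minus_one[of "2::real"] by (simp add: ln_div)
    then have "2 * ((K - 1) / (K + 1)) * ln (1/2) \<ge> 2 * ((K - 1) / (K + 1)) * (-1)"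
      using assms by (intro mult_left_mono) auto
    moreover have "4 * (K / (K + 1)) - 2 * ((K - 1) / (K + 1)) \<ge> 1"
    proof -
      have "K / (K + 1) = 1 - inverse (K + 1)" "(K - 1) / (K + 1) = 1 - 2 * inverse (K + 1)"
        using assms by (auto simp: divide_simps)
      then show ?thesis by simp
    qed
    ultimately show ?thesis by simp
  qed
  ultimately obtain r where "0 \<le> r" "r \<le> 1/2" "?F r = 1"
    using IVT'[of ?F 0 1 "1/2"] by auto
  then have "is_R K r" by (cases "r = 0") (auto simp: is_R_def)
  then show "\<exists>r. is_R K r" ..
  fix r s assume "is_R K r" "is_R K s"
  then show "r = s"
    using strict_mono_on_eqD[OF strict_mono_on_R_equation[OF assms], of r s] by (simp add: is_R_def)
qed

section \<open>The Bohr inequality\<close>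

text \<open>After division by any \<open>c > k\<close> the values of \<open>f\<close> lie in the open disk; then \<open>c\<close> tends to \<open>k\<close>.\<close>

lemma Schwarz_Lemma_scaled:
  assumes f: "f holomorphic_on \<D>" "f 0 = 0" and k: "\<And>z. z \<in> \<D> \<Longrightarrow> norm (f z) \<le> k" and z: "z \<in> \<D>"
  shows "norm (f z) \<le> k * norm z"
proof -
  have "k \<ge> 0" using k[of 0] f by simp
  have "norm (f z) \<le> c * norm z" if c: "c > k" for c
  proof -
    have "norm (f z / c) \<le> norm z"
    proof (rule Schwarz_Lemma)
      show "(\<lambda>z. f z / complex_of_real c) holomorphic_on ball 0 1"
        using c \<open>k \<ge> 0\<close> by (intro holomorphic_intros f) auto
      show "norm (f z / complex_of_real c) < 1" if "norm z < 1" for z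
        using k[of z] that c \<open>k \<ge> 0\<close> by (simp add: norm_divide divide_simps)
    qed (use f z in auto)
    then show ?thesis using c \<open>k \<ge> 0\<close> by (simp add: norm_divide field_simps)
  qed
  then have "eventually (\<lambda>c. norm (f z) \<le> c * norm z) (at_right k)"
    by (auto simp: eventually_at_right_less eventually_at_filter)
  moreover have "((\<lambda>c. c * norm z) \<longlongrightarrow> k * norm z) (at_right k)"
    by (intro tendsto_intros)
  ultimately show ?thesis
    by (intro tendsto_lowerbound[where F = "at_right k"]) auto
qed

lemma dilatation_bound:
  fixes x y K :: real
  assumes "0 \<le> y" "y < x" "K \<ge> 1" "(x + y) / (x - y) \<le> K"
  shows "y \<le> (K - 1) / (K + 1) * x"
  using assms by (simp add: divide_simps) (simp add: algebra_simps)

text \<open>Quasiconformality says that the analytic function \<open>g' / h'\<close> is bounded by \<open>k = (K - 1) / (K + 1)\<close>.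
  As the expansion of \<open>g\<close> starts with \<open>z\<^sup>2\<close>, this quotient vanishes at \<open>0\<close>, and the Schwarz lemma
  gains the factor \<open>\<bar>z\<bar>\<close>.\<close>

lemma bounded_qc_harmonic_deriv_bound:
  assumes K: "K \<ge> 1" and f: "bounded_qc_harmonic K f h g a b" and z: "z \<in> \<D>"
  shows "norm (deriv g z) \<le> (K - 1) / (K + 1) * norm z * norm (deriv h z)"
    and "deriv h z \<noteq> 0"
proof -
  have h: "h holomorphic_on \<D>" and g: "g holomorphic_on \<D>"
    and eq: "\<And>z. z \<in> \<D> \<Longrightarrow> f z = h z + cnj (g z)"
    and b: "\<And>z. z \<in> \<D> \<Longrightarrow> (\<lambda>n. b (n + 2) * z ^ (n + 2)) sums g z"
    and sp: "sense_preserving f" and qc: "quasiconformal K f"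
    using f by (auto simp: bounded_qc_harmonic_def)
  have W: "dz f z = deriv h z" "dzbar f z = cnj (deriv g z)"
    "jacobian f z = (norm (deriv h z))\<^sup>2 - (norm (deriv g z))\<^sup>2" if "z \<in> \<D>" for z
    using wirtinger_harmonic[OF open_ball h g eq that] by auto
  have less: "norm (deriv g z) < norm (deriv h z)" if "z \<in> \<D>" for z
  proof -
    have "jacobian f z > 0" using sp that by (simp add: sense_preserving_def)
    then have "(norm (deriv g z))\<^sup>2 < (norm (deriv h z))\<^sup>2" using W(3)[OF that] by simp
    then show ?thesis by (rule power2_less_imp_less) simp
  qed
  then have nz: "deriv h z \<noteq> 0" if "z \<in> \<D>" for z
    using that by fastforce
  have le: "norm (deriv g z) \<le> (K - 1) / (K + 1) * norm (deriv h z)" if "z \<in> \<D>" for z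
  proof -
    have "(norm (dz f z) + norm (dzbar f z)) / (norm (dz f z) - norm (dzbar f z)) \<le> K"
      using qc that unfolding quasiconformal_def by blast
    then show ?thesis
      using less[OF that] K by (intro dilatation_bound) (simp_all add: W(1,2)[OF that])
  qed
  have g0: "deriv g 0 = 0"
  proof -
    \<comment> \<open>The full coefficient sequence of \<open>g\<close>, whose expansion starts at \<open>n = 2\<close>.\<close>
    define c where "c n = (if n < 2 then 0 else b n)" for n
    have c: "(\<lambda>n. c n * z ^ n) sums g z" if "norm z < 1" for z
      using b[of z] that sums_zero_iff_shift[of 2 "\<lambda>n. c n * z ^ n" "g z"] by (simp add: c_def)
    have "(\<lambda>n. diffs c n * 0 ^ n) sums deriv g 0"
      by (rule termdiffs_sums_strong[OF c holomorphic_derivI[OF g open_ball]]) auto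
    then show ?thesis
      using sums_unique2[OF powser_sums_zero[of "diffs c"]] by (simp add: diffs_def c_def)
  qed
  have "norm (deriv g z / deriv h z) \<le> (K - 1) / (K + 1) * norm z"
  proof (rule Schwarz_Lemma_scaled[where f = "\<lambda>z. deriv g z / deriv h z"])
    show "(\<lambda>z. deriv g z / deriv h z) holomorphic_on \<D>"
      using h g nz by (intro holomorphic_intros holomorphic_deriv) auto
    show "norm (deriv g z / deriv h z) \<le> (K - 1) / (K + 1)" if "z \<in> \<D>" for z
      using le[OF that] nz[OF that] by (simp add: norm_divide pos_divide_le_eq)
  qed (use g0 z in auto)
  then show "norm (deriv g z) \<le> (K - 1) / (K + 1) * norm z * norm (deriv h z)"
    using nz[OF z] by (simp add: norm_divide pos_divide_le_eq)
  show "deriv h z \<noteq> 0" by (rule nz[OF z])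
qed

text \<open>On the circle of radius \<open>r\<close> the bound on \<open>g'\<close> reads \<open>\<bar>z g'(z)\<bar> \<le> k r \<bar>z h'(z)\<bar>\<close>.  Comparing
  square sums of coefficients,
  the sum of \<open>n\<^sup>2 \<bar>b\<^sub>n\<bar>\<^sup>2 r\<^sup>2\<^sup>n\<close> is at most \<open>k\<^sup>2 r\<^sup>2 W\<^sup>2\<close> times that of \<open>n\<^sup>2 r\<^sup>2\<^sup>n\<close>, which is
  \<open>r\<^sup>2 (1 + r\<^sup>2) / (1 - r\<^sup>2)\<^sup>3\<close>.  The square root of this bound enters the Cauchy-Schwarz
  estimate for \<open>\<bar>b\<^sub>n\<bar> r\<^sup>n\<close>.\<close>

lemma suminf_coanalytic_le:
  assumes h: "h holomorphic_on \<D>" and g: "g holomorphic_on \<D>"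
    and a: "\<And>z. z \<in> \<D> \<Longrightarrow> (\<lambda>n. a n * z ^ n) sums h z"
    and b: "\<And>z. z \<in> \<D> \<Longrightarrow> (\<lambda>n. b (n + 2) * z ^ (n + 2)) sums g z"
    and k: "0 \<le> k" "\<And>z. z \<in> \<D> \<Longrightarrow> norm (deriv g z) \<le> k * norm z * norm (deriv h z)"
    and W: "0 \<le> W" "\<And>n. n \<ge> 1 \<Longrightarrow> norm (a n) \<le> W" and r: "0 \<le> r" "r < 1"
  shows "(\<Sum>n. norm (b (n + 2)) * r ^ (n + 2)) \<le>
    W * (k * r\<^sup>2 * sqrt ((1 + r\<^sup>2) / (1 - r\<^sup>2) ^ 3) * sqrt (pi\<^sup>2 / 6 - 1))"
proof -
  define c where "c n = (if n < 2 then 0 else b n)" for n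
  have c: "(\<lambda>n. c n * z ^ n) sums g z" if "norm z < 1" for z
    using b[of z] that sums_zero_iff_shift[of 2 "\<lambda>n. c n * z ^ n" "g z"] by (simp add: c_def)
  have zg: "(\<lambda>n. of_nat n * c n * z ^ n) sums (z * deriv g z)" if "norm z < 1" for z
    by (rule sums_times_deriv[OF c holomorphic_derivI[OF g open_ball] that]) (use that in auto)
  have zh: "(\<lambda>n. of_nat n * a n * z ^ n) sums (z * deriv h z)" if "norm z < 1" for z
    by (rule sums_times_deriv[OF a holomorphic_derivI[OF h open_ball] that]) (use that in auto)
  have le: "norm (z * deriv g z) \<le> (k * r) * norm (z * deriv h z)" if "norm z = r" for z
    using mult_left_mono[OF k(2)[of z], of "norm z"] that r by (simp add: norm_mult mult_ac)
  note cmp = square_sum_coeffs_le[OF zg zh le r]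
  have norm_n: "norm (of_nat n * w) = real n * norm w" for n and w :: complex
    by (simp add: norm_mult)
  have r2: "r\<^sup>2 < 1" using r by (simp add: power_less_one_iff)
  have sq: "(\<lambda>n. W\<^sup>2 * ((real n)\<^sup>2 * (r\<^sup>2) ^ n)) sums (W\<^sup>2 * (r\<^sup>2 * (1 + r\<^sup>2) / (1 - r\<^sup>2) ^ 3))"
    by (rule sums_mult, rule sums_nat_power2_times_power) (use r2 in simp)
  have "(\<Sum>n. (real n * norm (a n))\<^sup>2 * r ^ (2 * n)) \<le> (\<Sum>n. W\<^sup>2 * ((real n)\<^sup>2 * (r\<^sup>2) ^ n))"
  proof (rule suminf_le)
    fix n
    have "real n * norm (a n) \<le> real n * W"
      using W by (cases "n = 0") (auto intro!: mult_left_mono)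
    then have "(real n * norm (a n))\<^sup>2 \<le> (real n * W)\<^sup>2"
      by (intro power_mono) auto
    then have "(real n * norm (a n))\<^sup>2 * r ^ (2 * n) \<le> (real n * W)\<^sup>2 * r ^ (2 * n)"
      using r by (intro mult_right_mono) auto
    then show "(real n * norm (a n))\<^sup>2 * r ^ (2 * n) \<le> W\<^sup>2 * ((real n)\<^sup>2 * (r\<^sup>2) ^ n)"
      unfolding power_mult_distrib power_mult by (simp add: mult_ac)
  qed (use cmp(2) sq in \<open>auto simp: norm_n sums_iff\<close>)
  also have "\<dots> = W\<^sup>2 * (r\<^sup>2 * (1 + r\<^sup>2) / (1 - r\<^sup>2) ^ 3)"
    using sq by (simp add: sums_iff)
  finally have A: "(\<Sum>n. (real n * norm (a n))\<^sup>2 * r ^ (2 * n)) \<le> W\<^sup>2 * (r\<^sup>2 * (1 + r\<^sup>2) / (1 - r\<^sup>2) ^ 3)" .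
  have "(\<Sum>n. (real n * norm (c n))\<^sup>2 * r ^ (2 * n)) \<le> (k * r)\<^sup>2 * (\<Sum>n. (real n * norm (a n))\<^sup>2 * r ^ (2 * n))"
    using cmp(3) by (simp add: norm_n)
  also have "\<dots> \<le> (k * r)\<^sup>2 * (W\<^sup>2 * (r\<^sup>2 * (1 + r\<^sup>2) / (1 - r\<^sup>2) ^ 3))"
    by (rule mult_left_mono[OF A]) simp
  also have "\<dots> = (W * k * r\<^sup>2)\<^sup>2 * ((1 + r\<^sup>2) / (1 - r\<^sup>2) ^ 3)"
    by (simp add: power_mult_distrib power2_eq_square)
  finally have "sqrt (\<Sum>n. (real n * norm (c n))\<^sup>2 * r ^ (2 * n)) \<le>
      sqrt ((W * k * r\<^sup>2)\<^sup>2 * ((1 + r\<^sup>2) / (1 - r\<^sup>2) ^ 3))"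
    by (rule real_sqrt_le_mono)
  also have "\<dots> = W * k * r\<^sup>2 * sqrt ((1 + r\<^sup>2) / (1 - r\<^sup>2) ^ 3)"
    unfolding real_sqrt_mult using W k r by simp
  finally have B: "sqrt (\<Sum>n. (real n * norm (c n))\<^sup>2 * r ^ (2 * n)) \<le>
      W * k * r\<^sup>2 * sqrt ((1 + r\<^sup>2) / (1 - r\<^sup>2) ^ 3)" .
  have "(\<Sum>n. norm (c (n + 2)) * r ^ (n + 2)) \<le>
      sqrt (\<Sum>n. (real n * norm (c n))\<^sup>2 * r ^ (2 * n)) * sqrt (pi\<^sup>2 / 6 - 1)"
    using cmp(1) r by (intro suminf_le_l2_derivative) (simp_all add: norm_n)
  also have "\<dots> \<le> W * k * r\<^sup>2 * sqrt ((1 + r\<^sup>2) / (1 - r\<^sup>2) ^ 3) * sqrt (pi\<^sup>2 / 6 - 1)"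
    using pi_power2_div_6_ge_1 by (intro mult_right_mono B) simp
  finally show ?thesis by (simp add: c_def mult_ac)
qed

text \<open>The two coefficient estimates have the common factor \<open>W\<close>, and add up to \<open>A + W M\<^sub>K(r)\<close>.\<close>

lemma bohr_inequality:
  assumes K: "K \<ge> 1" and rK: "is_rK K rK" and f: "bounded_qc_harmonic K f h g a b"
    and r: "0 \<le> r" "r \<le> rK"
  shows "bohr_sum a b r \<le> sup_norm h"
proof -
  define H where "H = sup_norm h"
  define A where "A = norm (a 0)"
  define W where "W = (H\<^sup>2 - A\<^sup>2) / H"
  define k where "k = (K - 1) / (K + 1)"
  have h: "h holomorphic_on \<D>" and g: "g holomorphic_on \<D>" and bd: "bounded (h ` \<D>)"
    and a: "\<And>z. z \<in> \<D> \<Longrightarrow> (\<lambda>n. a n * z ^ n) sums h z"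
    and b: "\<And>z. z \<in> \<D> \<Longrightarrow> (\<lambda>n. b (n + 2) * z ^ (n + 2)) sums g z"
    using f by (auto simp: bounded_qc_harmonic_def)
  have r1: "r < 1" using r rK by (simp add: is_rK_def)
  have hH: "norm (h z) \<le> H" if "z \<in> \<D>" for z
    unfolding H_def sup_norm_def
  proof (rule cSUP_upper[OF that])
    show "bdd_above ((\<lambda>z. norm (h z)) ` \<D>)"
      using bd by (auto simp: bounded_iff bdd_above_def)
  qed
  have "H \<noteq> 0"
  proof
    assume "H = 0"
    then have "\<And>z. z \<in> \<D> \<Longrightarrow> h z = 0" using hH by fastforce
    then have "(h has_field_derivative 0) (at 0)"
      by (intro has_field_derivative_transform_within_open[of "\<lambda>_. 0" 0 0 \<D> h]) auto
    then show False
      using bounded_qc_harmonic_deriv_bound(2)[OF K f, of 0] DERIV_imp_deriv by auto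
  qed
  moreover have "H \<ge> 0" using order_trans[OF norm_ge_zero hH[of 0]] by simp
  ultimately have H: "H > 0" by simp
  have "(\<lambda>n. a n * 0 ^ n) sums h 0" by (rule a) simp
  then have "a 0 = h 0" by (rule sums_unique2[OF powser_sums_zero])
  then have AH: "0 \<le> A" "A \<le> H" using hH[of 0] by (auto simp: A_def)
  then have "A\<^sup>2 \<le> H\<^sup>2" by (intro power_mono) auto
  then have W: "W \<ge> 0" using H by (simp add: W_def)
  have aW: "norm (a n) \<le> W" if "n \<ge> 1" for n
    unfolding W_def A_def using bounded_coeff_bound[of a h H n] a hH H that by simp
  obtain s where s: "r < s" "s < 1" using r1 dense by blast
  then have sa: "summable (\<lambda>n. norm (a n) * r ^ n)"
    using powser_insidea[OF sums_summable[OF a[of "of_real s"]], of "of_real r"] r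
    by (simp add: norm_mult norm_power)
  have "(\<Sum>n. norm (a n) * r ^ n) = A + (\<Sum>n. norm (a (Suc n)) * r ^ Suc n)"
    using suminf_split_head[OF sa] by (simp add: A_def)
  also have "(\<Sum>n. norm (a (Suc n)) * r ^ Suc n) \<le> (\<Sum>n. W * r * r ^ n)"
  proof (rule suminf_le)
    show "norm (a (Suc n)) * r ^ Suc n \<le> W * r * r ^ n" for n
      using mult_right_mono[OF aW[of "Suc n"], of "r ^ Suc n"] r by (simp add: mult_ac)
    show "summable (\<lambda>n. norm (a (Suc n)) * r ^ Suc n)"
      using sa by (subst summable_Suc_iff)
    show "summable (\<lambda>n. W * r * r ^ n)"
      using r r1 by (intro summable_mult summable_geometric) simp
  qed
  also have "(\<Sum>n. W * r * r ^ n) = W * (r / (1 - r))"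
    using r r1 by (simp add: suminf_mult suminf_geometric summable_geometric)
  finally have 1: "(\<Sum>n. norm (a n) * r ^ n) \<le> A + W * (r / (1 - r))" by simp
  have 2: "(\<Sum>n. norm (b (n + 2)) * r ^ (n + 2)) \<le>
      W * (k * r\<^sup>2 * sqrt ((1 + r\<^sup>2) / (1 - r\<^sup>2) ^ 3) * sqrt (pi\<^sup>2 / 6 - 1))"
    using K bounded_qc_harmonic_deriv_bound(1)[OF K f] r r1
    by (intro suminf_coanalytic_le[OF h g a b _ _ W aW]) (auto simp: k_def)
  have "bohr_sum a b r \<le> A + W * M K r"
    using 1 2 by (simp add: bohr_sum_def M_def k_def distrib_left)
  also have "M K r \<le> 1 / 2"
    using strict_mono_on_leD[OF strict_mono_on_M[OF K], of r rK] r rK by (simp add: is_rK_def)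
  then have "A + W * M K r \<le> A + W * (1 / 2)"
    using W by (intro add_left_mono mult_left_mono)
  also have "\<dots> \<le> H"
  proof -
    have "0 \<le> (H - A)\<^sup>2" by simp
    then have "2 * A * H + (H\<^sup>2 - A\<^sup>2) \<le> 2 * H * H" by (simp add: power2_eq_square algebra_simps)
    then show ?thesis using H by (simp add: W_def field_simps)
  qed
  finally show ?thesis by (simp add: H_def)
qed

section \<open>Weak derivatives of continuously differentiable functions\<close>

lemma continuous_on_extend_zero:
  fixes G :: "'a::topological_space \<Rightarrow> 'b::{topological_space,zero}"
  assumes "open S" "closed C" "C \<subseteq> S" "continuous_on S G" "\<And>z. z \<in> S - C \<Longrightarrow> G z = 0"
  shows "continuous_on UNIV (\<lambda>z. if z \<in> S then G z else 0)"
proof -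
  have "continuous_on (S \<union> - C) (\<lambda>z. if z \<in> S then G z else 0)"
  proof (rule continuous_on_open_Un)
    show "continuous_on S (\<lambda>z. if z \<in> S then G z else 0)"
      using assms(4) by (simp cong: continuous_on_cong_simp)
    show "continuous_on (- C) (\<lambda>z. if z \<in> S then G z else 0)"
      using assms(5) by (subst continuous_on_cong[OF refl, of _ _ "\<lambda>_. 0"]) auto
  qed (use assms in auto)
  moreover have "S \<union> - C = UNIV" using assms(3) by auto
  ultimately show ?thesis by simp
qed

lemma integrable_continuous_compact_support:
  fixes F :: "'a::euclidean_space \<Rightarrow> 'b::{banach, second_countable_topology}"
  assumes "continuous_on UNIV F" "compact C" "\<And>z. z \<notin> C \<Longrightarrow> F z = 0"
  shows "integrable lborel F"
proof -
  have "integrable lborel (\<lambda>x. indicator C x *\<^sub>R F x)"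
    using assms by (intro borel_integrable_compact) (auto intro: continuous_on_subset)
  moreover have "(\<lambda>x. indicator C x *\<^sub>R F x) = F"
    using assms(3) by (auto simp: indicator_def)
  ultimately show ?thesis by simp
qed

lemma pd_vector_derivative:
  assumes "F differentiable (at (z + t *\<^sub>R v))"
  shows "((\<lambda>t. F (z + t *\<^sub>R v)) has_vector_derivative pd v F (z + t *\<^sub>R v)) (at t)"
proof -
  have "(F has_derivative frechet_derivative F (at (z + t *\<^sub>R v))) (at (z + t *\<^sub>R v))"
    using assms frechet_derivative_works by blast
  then have "(F \<circ> (\<lambda>t. z + t *\<^sub>R v) has_derivative
      frechet_derivative F (at (z + t *\<^sub>R v)) \<circ> (\<lambda>s. s *\<^sub>R v)) (at t)"
    by (intro diff_chain_at) (auto intro!: derivative_eq_intros)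
  moreover have "frechet_derivative F (at (z + t *\<^sub>R v)) (s *\<^sub>R v) = s *\<^sub>R pd v F (z + t *\<^sub>R v)" for s
    using assms by (simp add: pd_def linear_frechet_derivative linear.scaleR)
  ultimately show ?thesis
    by (simp add: has_vector_derivative_def o_def)
qed

lemma pd_eq_0:
  assumes "open U" "z \<in> U" "\<And>w. w \<in> U \<Longrightarrow> F w = 0"
  shows "F differentiable (at z)" "pd v F z = 0"
proof -
  have "(F has_derivative (\<lambda>_. 0)) (at z)"
    by (rule has_derivative_transform_within_open[OF has_derivative_const assms(1,2)])
       (simp add: assms(3))
  then show "F differentiable (at z)" "pd v F z = 0"
    using frechet_derivative_at[of F "\<lambda>_. 0" z]
    by (auto simp: differentiable_def pd_def dest!: fun_cong[of _ _ v])
qed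

text \<open>By translation invariance every difference quotient \<open>n (F(z + v / n) - F(z))\<close> has integral \<open>0\<close>.
  These quotients are bounded by the maximum of the directional derivative and vanish outside one
  fixed ball, so their pointwise limit has integral \<open>0\<close> as well.\<close>

lemma integral_pd_compact_support:
  fixes F :: "complex \<Rightarrow> complex"
  assumes F: "C1_on UNIV F" and C: "compact C" "\<And>z. z \<notin> C \<Longrightarrow> F z = 0"
  shows "(LINT z|lborel. pd v F z) = 0"
proof -
  have diff: "F differentiable (at z)" for z
    using F by (simp add: C1_on_def)
  have cont: "continuous_on UNIV F"
    using diff by (simp add: continuous_on_eq_continuous_at differentiable_imp_continuous_within)
  have cpd: "continuous_on UNIV (pd v F)"
    using F by (simp add: C1_on_def)
  have pd0: "pd v F z = 0" if "z \<notin> C" for z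
    by (rule pd_eq_0[of "- C"]) (use that C in \<open>auto simp: compact_imp_closed\<close>)
  obtain B where B0: "B \<ge> 0" and B': "\<And>z. z \<in> C \<Longrightarrow> norm (pd v F z) \<le> B"
  proof -
    have "bounded (pd v F ` C)"
      using C cpd by (intro compact_imp_bounded compact_continuous_image)
        (auto intro: continuous_on_subset)
    then obtain B where "B > 0" "\<forall>x\<in>pd v F ` C. norm x \<le> B"
      unfolding bounded_pos by blast
    then show ?thesis
      using that[of B] by simp
  qed
  have B: "norm (pd v F z) \<le> B" for z
    using B' B0 pd0 by (cases "z \<in> C") auto
  have lip: "norm (F (z + t *\<^sub>R v) - F z) \<le> B * \<bar>t\<bar>" for z t
  proof -
    have "norm (F (z + t *\<^sub>R v) - F (z + 0 *\<^sub>R v)) \<le> B * norm (t - 0)"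
    proof (rule differentiable_bound[of UNIV])
      show "((\<lambda>t. F (z + t *\<^sub>R v)) has_derivative (\<lambda>s. s *\<^sub>R pd v F (z + t *\<^sub>R v)))
          (at t within UNIV)" for t
        using pd_vector_derivative[OF diff] by (simp add: has_vector_derivative_def)
      show "onorm (\<lambda>s. s *\<^sub>R pd v F (z + t *\<^sub>R v)) \<le> B" for t
        using mult_right_mono[OF B abs_ge_zero] by (intro onorm_le) (simp add: mult.commute)
    qed auto
    then show ?thesis by simp
  qed
  obtain R where R: "\<And>z. z \<in> C \<Longrightarrow> norm z \<le> R"
    using C(1) by (meson bounded_iff compact_imp_bounded)
  define s where "s n z = real (Suc n) *\<^sub>R (F (z + inverse (real (Suc n)) *\<^sub>R v) - F z)" for n z
  have intF: "integrable lborel F"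
    using cont C by (rule integrable_continuous_compact_support)
  have shift: "integrable lborel (\<lambda>z. F (z + c))" "(LINT z|lborel. F (z + c)) = (LINT z|lborel. F z)" for c
  proof -
    have *: "F \<in> borel_measurable borel"
      using cont by (rule borel_measurable_continuous_onI)
    show "(LINT z|lborel. F (z + c)) = (LINT z|lborel. F z)"
      using integral_distr[of "(+) c" lborel borel F] * by (simp add: lborel_distr_plus add.commute)
    show "integrable lborel (\<lambda>z. F (z + c))"
      using integrable_distr_eq[of "(+) c" lborel borel F] * intF
      by (simp add: lborel_distr_plus add.commute)
  qed
  have "(\<lambda>n. LINT z|lborel. s n z) \<longlonglongrightarrow> (LINT z|lborel. pd v F z)"
  proof (rule integral_dominated_convergence)
    show "pd v F \<in> borel_measurable lborel"
      using cpd by (simp add: borel_measurable_continuous_onI)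
    show "s n \<in> borel_measurable lborel" for n
      unfolding s_def using intF shift(1) by (intro borel_measurable_scaleR borel_measurable_diff) auto
    \<comment> \<open>The support of \<open>F\<close> lies in the ball of radius \<open>R\<close>, and the shifts have length at most \<open>\<bar>v\<bar>\<close>.\<close>
    show "integrable lborel (\<lambda>z::complex. B * indicator (cball 0 (R + norm v)) z)"
      using emeasure_bounded_finite[OF bounded_cball, of "0::complex" "R + norm v"]
      by (intro integrable_mult_right integrable_real_indicator) auto
    show "AE z in lborel. (\<lambda>n. s n z) \<longlonglongrightarrow> pd v F z"
    proof (rule AE_I2)
      fix z
      have "((\<lambda>t. F (z + t *\<^sub>R v)) has_vector_derivative pd v F z) (at 0)"
        using pd_vector_derivative[of F z 0 v] diff by simp
      then have lim: "((\<lambda>t. norm (F (z + t *\<^sub>R v) - F z - t *\<^sub>R pd v F z) / norm t) \<longlongrightarrow> 0) (at 0)"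
        by (simp add: has_vector_derivative_def has_derivative_at)
      have "filterlim (\<lambda>n. inverse (real (Suc n))) (at 0) sequentially"
        using LIMSEQ_inverse_real_of_nat by (simp add: filterlim_at)
      from filterlim_compose[OF lim this]
      moreover have "norm (s n z - pd v F z) = norm (F (z + inverse (real (Suc n)) *\<^sub>R v) - F z
          - inverse (real (Suc n)) *\<^sub>R pd v F z) / norm (inverse (real (Suc n)))" for n
      proof -
        have "s n z - pd v F z = real (Suc n) *\<^sub>R (F (z + inverse (real (Suc n)) *\<^sub>R v) - F z
          - inverse (real (Suc n)) *\<^sub>R pd v F z)"
          unfolding s_def scaleR_diff_right by (simp del: of_nat_Suc)
        then show ?thesis by (simp add: divide_inverse mult.commute del: of_nat_Suc)
      qed
      ultimately have "(\<lambda>n. norm (s n z - pd v F z)) \<longlonglongrightarrow> 0" by simp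
      then show "(\<lambda>n. s n z) \<longlonglongrightarrow> pd v F z"
        by (simp add: tendsto_norm_zero_iff LIM_zero_iff)
    qed
    show "AE z in lborel. norm (s n z) \<le> B * indicator (cball 0 (R + norm v)) z" for n
    proof (rule AE_I2)
      fix z
      let ?t = "inverse (real (Suc n))"
      show "norm (s n z) \<le> B * indicator (cball 0 (R + norm v)) z"
      proof (cases "norm z \<le> R + norm v")
        case True
        have "norm (s n z) \<le> real (Suc n) * (B * \<bar>?t\<bar>)"
          unfolding s_def using lip[of z ?t] by (simp add: mult_left_mono del: of_nat_Suc)
        also have "real (Suc n) * (B * \<bar>?t\<bar>) = B" by (simp add: field_simps)
        finally show ?thesis using True by simp
      next
        case False
        have "norm (?t *\<^sub>R v) \<le> norm v"
          by (simp add: mult_left_le_one_le inverse_le_1_iff del: of_nat_Suc)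
        then have "norm (z + ?t *\<^sub>R v) > R"
          using False norm_diff_ineq[of z "?t *\<^sub>R v"] by linarith
        moreover have "norm z > R" using False norm_ge_zero[of v] by linarith
        ultimately have "F (z + ?t *\<^sub>R v) = 0" "F z = 0"
          using C(2) R by (meson not_le)+
        then show ?thesis using False by (simp add: s_def)
      qed
    qed
  qed
  moreover have "(LINT z|lborel. s n z) = 0" for n
    unfolding s_def using shift intF by simp
  ultimately show ?thesis
    by (simp add: LIMSEQ_unique)
qed

text \<open>Extended by \<open>0\<close>, the product \<open>\<phi> f\<close> is continuously differentiable on the plane and has compact
  support.  Its directional derivatives integrate to \<open>0\<close>, and the product rule splits them into
  the two sides of the integration by parts formula.\<close>

lemma C1_on_imp_weak_pd:
  assumes "open S" and f: "C1_on S f"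
  shows "weak_pd S v f (pd v f)"
  unfolding weak_pd_def
proof (intro allI impI)
  fix \<phi> assume "test_function S \<phi>"
  then obtain C where \<phi>: "C1_on UNIV \<phi>" and C: "compact C" "C \<subseteq> S" and \<phi>0: "\<And>z. z \<notin> C \<Longrightarrow> \<phi> z = 0"
    by (auto simp: test_function_def)
  have clC: "closed C" using C by (simp add: compact_imp_closed)
  have pd\<phi>0: "pd w \<phi> z = 0" if "z \<notin> C" for z w
    by (rule pd_eq_0[of "- C"]) (use that clC \<phi>0 in auto)
  have d\<phi>: "(\<phi> has_derivative (\<lambda>w. pd w \<phi> z)) (at z)" for z
    using \<phi> frechet_derivative_works by (fastforce simp: C1_on_def pd_def)
  have df: "(f has_derivative (\<lambda>w. pd w f z)) (at z)" if "z \<in> S" for z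
    using f that frechet_derivative_works by (fastforce simp: C1_on_def pd_def)
  have cont\<phi>: "continuous_on S \<phi>"
    by (intro continuous_at_imp_continuous_on ballI has_derivative_continuous[OF d\<phi>])
  have contf: "continuous_on S f"
    by (intro continuous_at_imp_continuous_on ballI has_derivative_continuous[OF df])
  have cpd: "continuous_on S (pd w \<phi>)" "continuous_on S (pd w f)" for w
    using \<phi> f by (auto simp: C1_on_def intro: continuous_on_subset)
  define F where "F z = (if z \<in> S then \<phi> z *\<^sub>R f z else 0)" for z
  define P where "P w z = (if z \<in> S then pd w \<phi> z *\<^sub>R f z else 0)" for w z
  define Q where "Q w z = (if z \<in> S then \<phi> z *\<^sub>R pd w f z else 0)" for w z
  have contP: "continuous_on UNIV (P w)" for w
    unfolding P_def using C clC assms(1) pd\<phi>0 contf cpd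
    by (intro continuous_on_extend_zero[of S C]) (auto intro!: continuous_intros)
  have contQ: "continuous_on UNIV (Q w)" for w
    unfolding Q_def using C clC assms(1) \<phi>0 cont\<phi> cpd
    by (intro continuous_on_extend_zero[of S C]) (auto intro!: continuous_intros)
  have P0: "P w z = 0" and Q0: "Q w z = 0" if "z \<notin> C" for w z
    using that pd\<phi>0 \<phi>0 by (auto simp: P_def Q_def)
  have F0: "F z = 0" if "z \<notin> C" for z
    using that \<phi>0 by (simp add: F_def)
  have dF: "(F has_derivative (\<lambda>w. P w z + Q w z)) (at z)" for z
  proof (cases "z \<in> S")
    case True
    have "((\<lambda>z. \<phi> z *\<^sub>R f z) has_derivative (\<lambda>w. \<phi> z *\<^sub>R pd w f z + pd w \<phi> z *\<^sub>R f z)) (at z)"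
      by (rule has_derivative_scaleR[OF d\<phi> df[OF True]])
    then have "(F has_derivative (\<lambda>w. \<phi> z *\<^sub>R pd w f z + pd w \<phi> z *\<^sub>R f z)) (at z)"
      by (rule has_derivative_transform_within_open[OF _ assms(1) True]) (simp add: F_def)
    then show ?thesis using True by (simp add: P_def Q_def add.commute)
  next
    case False
    then have "z \<notin> C" using C by auto
    have "(F has_derivative (\<lambda>_. 0)) (at z)"
      by (rule has_derivative_transform_within_open[OF has_derivative_const, of "- C"])
         (use clC \<open>z \<notin> C\<close> F0 in auto)
    then show ?thesis using P0 Q0 \<open>z \<notin> C\<close> by simp
  qed
  have pdF: "pd w F z = P w z + Q w z" for w z
    using frechet_derivative_at[OF dF, symmetric] by (simp add: pd_def)
  have "C1_on UNIV F"
    using dF contP contQ by (auto simp: C1_on_def differentiable_def pdF[abs_def] intro!: continuous_intros)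
  then have "(LINT z|lborel. P v z + Q v z) = 0"
    using integral_pd_compact_support[of F C v] C(1) F0 by (simp add: pdF)
  moreover have "integrable lborel (P v)" "integrable lborel (Q v)"
    using contP contQ P0 Q0 C(1) by (auto intro: integrable_continuous_compact_support)
  ultimately have "(LINT z|lborel. P v z) = - (LINT z|lborel. Q v z)"
    by (simp add: eq_neg_iff_add_eq_0)
  moreover have "P v \<in> borel_measurable borel" "Q v \<in> borel_measurable borel"
    using contP contQ by (auto intro: borel_measurable_continuous_onI)
  ultimately have *: "(LINT z|lebesgue. P v z) = - (LINT z|lebesgue. Q v z)"
    by (simp add: integral_completion)
  have S: "S \<in> sets lebesgue" using assms(1) by simp
  show "(LINT z|lebesgue_on S. pd v \<phi> z *\<^sub>R f z) = - (LINT z|lebesgue_on S. \<phi> z *\<^sub>R pd v f z)"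
    using * Lebesgue_Measure.integral_restrict_UNIV[OF S, of "\<lambda>z. pd v \<phi> z *\<^sub>R f z"]
      Lebesgue_Measure.integral_restrict_UNIV[OF S, of "\<lambda>z. \<phi> z *\<^sub>R pd v f z"]
    by (simp add: P_def Q_def)
qed

lemma continuous_on_imp_L2_loc:
  assumes "open S" "continuous_on S u"
  shows "L2_loc S u"
  unfolding L2_loc_def
proof (intro conjI allI impI)
  show "u \<in> borel_measurable (lebesgue_on S)"
    using assms by (intro continuous_imp_measurable_on_sets_lebesgue) auto
  fix C assume C: "compact C \<and> C \<subseteq> S"
  have "integrable lborel (\<lambda>z. indicator C z *\<^sub>R (norm (u z))\<^sup>2)"
    using assms C by (intro borel_integrable_compact continuous_intros) (auto intro: continuous_on_subset)
  then have "integrable lebesgue (\<lambda>z. indicator C z *\<^sub>R (norm (u z))\<^sup>2)"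
    by (simp add: integrable_completion)
  then show "integrable (lebesgue_on C) (\<lambda>z. (norm (u z))\<^sup>2)"
    using C by (subst integrable_restrict_space) (auto simp: compact_imp_closed borel_closed)
qed

lemma C1_on_imp_W12_loc:
  assumes "open S" "C1_on S f"
  shows "W12_loc S f"
proof -
  have "continuous_on S f"
    using assms by (auto simp: C1_on_def continuous_on_eq_continuous_at intro: differentiable_imp_continuous_within)
  moreover have "continuous_on S (pd v f)" for v
    using assms by (simp add: C1_on_def)
  ultimately show ?thesis
    using assms by (auto simp: W12_loc_def intro: continuous_on_imp_L2_loc C1_on_imp_weak_pd)
qed

section \<open>Harmonic maps whose analytic part has a convex image\<close>

text \<open>The composition of \<open>g\<close> with the inverse of \<open>h\<close> has derivative \<open>g' / h'\<close>, which is bounded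
  by \<open>k\<close> on a convex set.\<close>

lemma norm_diff_le_convex_image:
  assumes "open S" "h holomorphic_on S" "g holomorphic_on S" "inj_on h S" "convex (h ` S)"
    and k: "\<And>z. z \<in> S \<Longrightarrow> norm (deriv g z) \<le> k * norm (deriv h z)"
    and z: "z \<in> S" "w \<in> S"
  shows "norm (g z - g w) \<le> k * norm (h z - h w)"
proof -
  obtain p where p: "p holomorphic_on (h ` S)" "\<And>z. z \<in> S \<Longrightarrow> deriv h z * deriv p (h z) = 1"
    "\<And>z. z \<in> S \<Longrightarrow> p (h z) = z"
    using holomorphic_has_inverse[OF assms(2,1,4)] by metis
  have op: "open (h ` S)"
    by (rule open_mapping_thm3[OF assms(2,1,4)])
  have "norm ((g \<circ> p) (h z) - (g \<circ> p) (h w)) \<le> k * norm (h z - h w)"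
  proof (rule field_differentiable_bound[OF assms(5)])
    fix u assume "u \<in> h ` S"
    then obtain z where z: "z \<in> S" "u = h z" by auto
    have "(p has_field_derivative deriv p u) (at u)"
      using holomorphic_derivI[OF p(1) op] \<open>u \<in> h ` S\<close> by blast
    moreover have "(g has_field_derivative deriv g (p u)) (at (p u))"
      using holomorphic_derivI[OF assms(3,1) z(1)] z p(3) by simp
    ultimately have "(g \<circ> p has_field_derivative deriv g (p u) * deriv p u) (at u)"
      by (intro DERIV_chain)
    then show "(g \<circ> p has_field_derivative deriv g (p u) * deriv p u) (at u within h ` S)"
      by (rule has_field_derivative_at_within)
    have "norm (deriv g (p u) * deriv p u) \<le> k * norm (deriv h z) * norm (deriv p u)"
      unfolding norm_mult using k[OF z(1)] z p(3) by (intro mult_right_mono) auto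
    also have "\<dots> = k"
      using arg_cong[OF p(2)[OF z(1)], of norm] z by (simp add: norm_mult)
    finally show "norm (deriv g (p u) * deriv p u) \<le> k" .
  qed (use z in auto)
  then show ?thesis
    using p(3) z by simp
qed

text \<open>As a function of \<open>w = h(z)\<close>, the map \<open>f\<close> is \<open>w + cnj (G w)\<close> with \<open>G\<close> of Lipschitz constant less than
  \<open>1\<close>; hence it is injective, and invariance of domain makes it a homeomorphism onto a domain.  The
  remaining conditions follow from smoothness and from the bound on the dilatation.\<close>

lemma quasiconformal_harmonic_convex:
  assumes K: "K \<ge> 1" and h: "h holomorphic_on \<D>" "inj_on h \<D>" "convex (h ` \<D>)"
    and g: "g holomorphic_on \<D>"
    and f: "\<And>z. z \<in> \<D> \<Longrightarrow> f z = h z + cnj (g z)"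
    and dil: "\<And>z. z \<in> \<D> \<Longrightarrow> norm (deriv g z) \<le> (K - 1) / (K + 1) * norm (deriv h z)"
  shows "quasiconformal K f"
proof -
  define k where "k = (K - 1) / (K + 1)"
  have k: "0 \<le> k" "k < 1" "k * (K + 1) = K - 1" using K by (auto simp: k_def)
  have W: "dz f z = deriv h z" "dzbar f z = cnj (deriv g z)"
    "jacobian f z = (norm (deriv h z))\<^sup>2 - (norm (deriv g z))\<^sup>2" if "z \<in> \<D>" for z
    using wirtinger_harmonic[OF open_ball h(1) g f that] by auto
  have h': "deriv h z \<noteq> 0" if "z \<in> \<D>" for z
    using holomorphic_injective_imp_regular[OF h(1) _ h(2) that] by simp
  have less: "norm (deriv g z) < norm (deriv h z)" if z: "z \<in> \<D>" for z
  proof -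
    have "k * norm (deriv h z) < 1 * norm (deriv h z)"
      using k h'[OF z] by (intro mult_strict_right_mono) auto
    then show ?thesis using dil[OF z] by (simp add: k_def)
  qed
  have sp: "sense_preserving f"
    unfolding sense_preserving_def
  proof (intro ballI conjI)
    fix z assume z: "z \<in> \<D>"
    show "f differentiable (at z)"
      using has_derivative_harmonic[OF open_ball h(1) g f z] by (auto simp: differentiable_def)
    show "jacobian f z > 0"
      using less[OF z] by (simp add: W(3)[OF z] power_strict_mono)
  qed
  have cont: "continuous_on \<D> f"
    using sp by (auto simp: sense_preserving_def intro!: continuous_at_imp_continuous_on
        differentiable_imp_continuous_within)
  have inj: "inj_on f \<D>"
  proof (rule inj_onI)
    fix z w assume zw: "z \<in> \<D>" "w \<in> \<D>" "f z = f w"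
    have "h z - h w = - cnj (g z - g w)"
      using zw by (simp add: f algebra_simps)
    then have "norm (h z - h w) = norm (g z - g w)"
      by (metis complex_mod_cnj norm_minus_cancel)
    also have "\<dots> \<le> k * norm (h z - h w)"
      using norm_diff_le_convex_image[OF open_ball h(1) g h(2,3) dil zw(1,2)]
      by (simp add: k_def)
    finally have "(1 - k) * norm (h z - h w) \<le> 0" by (simp add: algebra_simps)
    then have "h z = h w" using k by (simp add: mult_le_0_iff)
    then show "z = w" using h(2) zw by (simp add: inj_on_def)
  qed
  obtain p where "homeomorphism \<D> (f ` \<D>) f p"
    using invariance_of_domain_homeomorphism[OF open_ball cont _ inj] by auto
  moreover have "open (f ` \<D>)"
    by (rule invariance_of_domain[OF cont open_ball inj])
  moreover have "connected (f ` \<D>)"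
    by (intro connected_continuous_image cont connected_ball)
  ultimately have "\<exists>\<Omega> finv. open \<Omega> \<and> connected \<Omega> \<and> homeomorphism \<D> \<Omega> f finv" by blast
  moreover have "W12_loc \<D> f"
    by (intro C1_on_imp_W12_loc C1_on_harmonic[OF open_ball h(1) g f] open_ball)
  moreover have "(norm (dz f z) + norm (dzbar f z)) / (norm (dz f z) - norm (dzbar f z)) \<le> K"
    if z: "z \<in> \<D>" for z
  proof -
    have "norm (deriv g z) * (K + 1) \<le> k * norm (deriv h z) * (K + 1)"
      using dil[OF z] K by (intro mult_right_mono) (auto simp: k_def)
    also have "\<dots> = (K - 1) * norm (deriv h z)"
      using k(3) by (simp add: mult_ac)
    finally have "norm (deriv h z) + norm (deriv g z) \<le> K * (norm (deriv h z) - norm (deriv g z))"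
      by (simp add: algebra_simps)
    then show ?thesis
      using less[OF z] by (simp add: W(1,2)[OF z] pos_divide_le_eq)
  qed
  ultimately show ?thesis
    using sp by (simp add: quasiconformal_def)
qed

section \<open>The extremal maps\<close>

definition disk_involution :: "real \<Rightarrow> complex \<Rightarrow> complex" where
  "disk_involution a z = (of_real a - z) / (1 - of_real a * z)"

text \<open>The primitive of \<open>k z h'(z)\<close> with value \<open>0\<close> at \<open>0\<close>, where \<open>h\<close> is the involution.\<close>

definition extremal_g :: "real \<Rightarrow> real \<Rightarrow> complex \<Rightarrow> complex" where
  "extremal_g k a z = - of_real (k * (1 - a\<^sup>2) / a\<^sup>2) * (of_real a * z / (1 - of_real a * z) + Ln (1 - of_real a * z))"

lemma one_minus_mult_disk:
  assumes "0 < a" "a < 1" "z \<in> \<D>"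
  shows "norm (complex_of_real a * z) < 1" "Re (1 - complex_of_real a * z) > 0"
    "1 - complex_of_real a * z \<noteq> 0"
proof -
  have "a * norm z < 1 * 1" using assms by (intro mult_strict_mono) auto
  then show *: "norm (complex_of_real a * z) < 1" using assms by (simp add: norm_mult)
  show "Re (1 - complex_of_real a * z) > 0"
    using complex_Re_le_cmod[of "complex_of_real a * z"] * by simp
  show "1 - complex_of_real a * z \<noteq> 0"
    using * by (metis less_irrefl norm_one right_minus_eq)
qed

lemma DERIV_disk_involution:
  assumes "0 < a" "a < 1" "z \<in> \<D>"
  shows "(disk_involution a has_field_derivative - of_real (1 - a\<^sup>2) / (1 - of_real a * z)\<^sup>2) (at z)"
proof -
  have "1 - of_real a * z \<noteq> 0" by (rule one_minus_mult_disk(3)[OF assms])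
  then show ?thesis
    unfolding disk_involution_def[abs_def]
    by (auto intro!: derivative_eq_intros simp: power2_eq_square field_simps)
qed

lemma DERIV_extremal_g:
  assumes "0 < a" "a < 1" "z \<in> \<D>"
  shows "(extremal_g k a has_field_derivative of_real k * z * (- of_real (1 - a\<^sup>2) / (1 - of_real a * z)\<^sup>2)) (at z)"
proof -
  have pos: "Re (1 - of_real a * z) > 0" by (rule one_minus_mult_disk(2)[OF assms])
  have nz: "1 - of_real a * z \<noteq> 0" by (rule one_minus_mult_disk(3)[OF assms])
  have np: "1 - of_real a * z \<notin> \<real>\<^sub>\<le>\<^sub>0" using pos by (auto simp: complex_nonpos_Reals_iff)
  have d1: "((\<lambda>z. of_real a * z / (1 - of_real a * z)) has_field_derivative of_real a / (1 - of_real a * z)\<^sup>2) (at z)"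
    using nz by (auto intro!: derivative_eq_intros simp: power2_eq_square field_simps)
  have d2: "((\<lambda>z. Ln (1 - of_real a * z)) has_field_derivative - of_real a / (1 - of_real a * z)) (at z)"
    using np by (auto intro!: derivative_eq_intros simp: field_simps)
  have "of_real a / (1 - of_real a * z)\<^sup>2 + - of_real a / (1 - of_real a * z) = (of_real a)\<^sup>2 * z / (1 - of_real a * z)\<^sup>2"
    using nz by (simp add: divide_simps) (simp add: power2_eq_square algebra_simps)
  then have "- of_real (k * (1 - a\<^sup>2) / a\<^sup>2) * (of_real a / (1 - of_real a * z)\<^sup>2 + - of_real a / (1 - of_real a * z))
      = - of_real (k * (1 - a\<^sup>2) / a\<^sup>2) * ((of_real a)\<^sup>2 * z / (1 - of_real a * z)\<^sup>2)"
    by (simp only:)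
  also have "\<dots> = of_real k * z * (- of_real (1 - a\<^sup>2) / (1 - of_real a * z)\<^sup>2)"
  proof -
    have "of_real (k * (1 - a\<^sup>2) / a\<^sup>2) * (complex_of_real a)\<^sup>2 = of_real k * of_real (1 - a\<^sup>2)"
      using assms(1) by simp
    moreover have "- c * (u * z / d) = - (c * u) * z / d" "l * z * (- m / d) = - (l * m) * z / d"
      for c u d l m :: complex by simp_all
    ultimately show ?thesis by (simp only:)
  qed
  finally have eq: "- of_real (k * (1 - a\<^sup>2) / a\<^sup>2) * (of_real a / (1 - of_real a * z)\<^sup>2 + - of_real a / (1 - of_real a * z))
      = of_real k * z * (- of_real (1 - a\<^sup>2) / (1 - of_real a * z)\<^sup>2)" .
  show ?thesis
    using DERIV_cmult[OF DERIV_add[OF d1 d2], of "- of_real (k * (1 - a\<^sup>2) / a\<^sup>2)"]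
    unfolding extremal_g_def[abs_def] eq .
qed

text \<open>The map is its own inverse, so it suffices that it sends the disk into itself.\<close>

lemma disk_involution_self_map:
  assumes "0 < a" "a < 1"
  shows "disk_involution a ` \<D> = \<D>" "inj_on (disk_involution a) \<D>"
proof -
  have in_disk: "disk_involution a z \<in> \<D>" if "z \<in> \<D>" for z
  proof -
    have "disk_involution a z = - Moebius_function 0 (of_real a) z"
      by (simp add: disk_involution_def Moebius_function_simple minus_divide_left)
    then show ?thesis
      using Moebius_function_norm_lt_1[of "of_real a" z 0] assms that by simp
  qed
  have inv: "disk_involution a (disk_involution a z) = z" if "z \<in> \<D>" for z
  proof -
    have nz: "1 - of_real a * z \<noteq> 0" by (rule one_minus_mult_disk(3)[OF assms that])
    have "a\<^sup>2 < 1" using assms by (simp add: power_less_one_iff)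
    then have a: "1 - (complex_of_real a)\<^sup>2 \<noteq> 0"
      by (metis less_irrefl of_real_1 of_real_eq_iff of_real_power right_minus_eq)
    have "of_real a - disk_involution a z = (1 - (of_real a)\<^sup>2) * z / (1 - of_real a * z)"
      "1 - of_real a * disk_involution a z = (1 - (of_real a)\<^sup>2) / (1 - of_real a * z)"
      using nz by (simp_all add: disk_involution_def field_simps power2_eq_square)
    then show ?thesis
      unfolding disk_involution_def[of a "disk_involution a z"] using nz a by simp
  qed
  show "disk_involution a ` \<D> = \<D>"
    using in_disk inv by (metis (no_types, lifting) image_subset_iff image_eqI subsetI subset_antisym)
  show "inj_on (disk_involution a) \<D>"
    using inv by (metis inj_onI)
qed

lemma sums_moebius_quotient:
  fixes x :: "'a::{real_normed_field,banach}"
  assumes "norm (A * x) < 1"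
  shows "(\<lambda>n. (if n = 0 then A else - (1 - A\<^sup>2) * A ^ (n - 1)) * x ^ n) sums ((A - x) / (1 - A * x))"
proof -
  have nz: "1 - A * x \<noteq> 0" using assms by auto
  have "(\<lambda>n. - (1 - A\<^sup>2) * x * (A * x) ^ n) sums (- (1 - A\<^sup>2) * x * (1 / (1 - A * x)))"
    by (intro sums_mult geometric_sums assms)
  also have "- (1 - A\<^sup>2) * x * (1 / (1 - A * x)) = (A - x) / (1 - A * x) - A"
    using nz by (simp add: field_simps power2_eq_square)
  also have "(\<lambda>n. - (1 - A\<^sup>2) * x * (A * x) ^ n) =
      (\<lambda>n. (if Suc n = 0 then A else - (1 - A\<^sup>2) * A ^ (Suc n - 1)) * x ^ Suc n)"
    by (auto simp: power_mult_distrib mult_ac)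
  finally show ?thesis by (subst (asm) sums_Suc_iff) simp
qed

text \<open>The geometric series minus the logarithmic series: their terms of order \<open>1\<close> cancel, so that the
  sum starts with \<open>w\<^sup>2\<close>.\<close>

lemma sums_geometric_minus_log:
  fixes w :: complex
  assumes "norm w < 1"
  shows "(\<lambda>n. (1 - 1 / of_nat (n + 2)) * w ^ (n + 2)) sums (w / (1 - w) + Ln (1 - w))"
proof -
  have "(\<lambda>n. - (w ^ n) / of_nat n) sums Ln (1 - w)"
    using Ln_series'[of "- w"] assms by simp
  moreover have "(\<lambda>n. w ^ n) sums (1 / (1 - w))"
    using assms by (rule geometric_sums)
  ultimately have "(\<lambda>n. w ^ n + - (w ^ n) / of_nat n) sums (1 / (1 - w) + Ln (1 - w))"
    by (rule sums_add[rotated])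
  then have "(\<lambda>n. w ^ (n + 2) + - (w ^ (n + 2)) / of_nat (n + 2)) sums (1 / (1 - w) + Ln (1 - w) - 1)"
    by (subst sums_iff_shift) (simp add: numeral_2_eq_2)
  moreover have "1 / (1 - w) + Ln (1 - w) - 1 = w / (1 - w) + Ln (1 - w)"
  proof -
    have "1 - w \<noteq> 0" using assms by auto
    then show ?thesis by (simp add: divide_simps)
  qed
  ultimately show ?thesis by (simp add: algebra_simps)
qed

definition involution_coeff :: "real \<Rightarrow> nat \<Rightarrow> real" where
  "involution_coeff a n = (if n = 0 then a else - (1 - a\<^sup>2) * a ^ (n - 1))"

definition extremal_g_coeff :: "real \<Rightarrow> real \<Rightarrow> nat \<Rightarrow> real" where
  "extremal_g_coeff k a n = - (k * (1 - a\<^sup>2)) * (1 - 1 / real n) * a ^ (n - 2)"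

lemma sums_disk_involution:
  assumes "0 < a" "a < 1" "z \<in> \<D>"
  shows "(\<lambda>n. of_real (involution_coeff a n) * z ^ n) sums disk_involution a z"
proof -
  have "(\<lambda>n. of_real (involution_coeff a n) * z ^ n) = (\<lambda>n. (if n = 0 then of_real a else
      - (1 - (of_real a)\<^sup>2) * of_real a ^ (n - 1)) * z ^ n)"
    by (auto simp: involution_coeff_def)
  then show ?thesis
    using sums_moebius_quotient[OF one_minus_mult_disk(1)[OF assms]] by (simp add: disk_involution_def)
qed

lemma sums_extremal_g:
  assumes "0 < a" "a < 1" "z \<in> \<D>"
  shows "(\<lambda>n. of_real (extremal_g_coeff k a (n + 2)) * z ^ (n + 2)) sums extremal_g k a z"
proof -
  have "of_real (extremal_g_coeff k a (n + 2)) * z ^ (n + 2) = - of_real (k * (1 - a\<^sup>2) / a\<^sup>2) *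
      ((1 - 1 / of_nat (n + 2)) * (of_real a * z) ^ (n + 2))" for n
    using assms by (simp add: extremal_g_coeff_def power_mult_distrib power_add power2_eq_square del: of_nat_add)
  then show ?thesis
    unfolding extremal_g_def
    by (simp only: sums_mult[OF sums_geometric_minus_log[OF one_minus_mult_disk(1)[OF assms]]])
qed

lemma bounded_qc_harmonic_extremal:
  assumes K: "K \<ge> 1" and a: "0 < a" "a < 1" and k: "k = (K - 1) / (K + 1)"
  shows "bounded_qc_harmonic K (\<lambda>z. disk_involution a z + cnj (extremal_g k a z)) (disk_involution a) (extremal_g k a)
    (\<lambda>n. of_real (involution_coeff a n)) (\<lambda>n. of_real (extremal_g_coeff k a n))"
proof -
  have h: "disk_involution a holomorphic_on \<D>" and g: "extremal_g k a holomorphic_on \<D>"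
    unfolding holomorphic_on_open[OF open_ball] using DERIV_disk_involution[OF a] DERIV_extremal_g[OF a] by blast+
  have "k \<ge> 0" using K k by simp
  have qc: "quasiconformal K (\<lambda>z. disk_involution a z + cnj (extremal_g k a z))"
  proof (rule quasiconformal_harmonic_convex[OF K h _ _ g])
    show "inj_on (disk_involution a) \<D>" "convex (disk_involution a ` \<D>)"
      using disk_involution_self_map[OF a] by auto
    fix z assume z: "z \<in> \<D>"
    have "deriv (extremal_g k a) z = of_real k * z * deriv (disk_involution a) z"
      using DERIV_imp_deriv[OF DERIV_extremal_g[OF a z]] DERIV_imp_deriv[OF DERIV_disk_involution[OF a z]] by simp
    then have "norm (deriv (extremal_g k a) z) = (k * norm z) * norm (deriv (disk_involution a) z)"
      using \<open>k \<ge> 0\<close> by (simp add: norm_mult)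
    also have "\<dots> \<le> k * norm (deriv (disk_involution a) z)"
      using z \<open>k \<ge> 0\<close> by (intro mult_right_mono mult_right_le_one_le) auto
    finally show "norm (deriv (extremal_g k a) z) \<le> (K - 1) / (K + 1) * norm (deriv (disk_involution a) z)"
      by (simp add: k)
  qed simp
  have "bounded (disk_involution a ` \<D>)" using disk_involution_self_map(1)[OF a] by simp
  moreover have "harmonic_on \<D> (\<lambda>z. disk_involution a z + cnj (extremal_g k a z))"
    by (rule harmonic_on_holomorphic_add_cnj[OF open_ball h g]) simp
  ultimately show ?thesis
    using h g qc sums_disk_involution[OF a] sums_extremal_g[OF a]
    by (simp add: bounded_qc_harmonic_def quasiconformal_def)
qed

text \<open>Apart from \<open>a\<^sub>0 = a > 0\<close> all coefficients are at most \<open>0\<close>.  The sums of their absolute values are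
  therefore \<open>2 a - h(r)\<close> and \<open>- g(r)\<close>.\<close>

lemma bohr_sum_extremal:
  assumes a: "0 < a" "a < 1" and k: "0 \<le> k" and r: "0 < r" "r < 1"
  shows "bohr_sum (\<lambda>n. of_real (involution_coeff a n)) (\<lambda>n. of_real (extremal_g_coeff k a n)) r =
    a + (1 - a\<^sup>2) * (r / (1 - a * r) + k / a\<^sup>2 * (a * r / (1 - a * r) + ln (1 - a * r)))"
proof -
  have ar: "0 < a * r" "a * r < 1"
    using a r mult_strict_mono[of a 1 r 1] by auto
  have a2: "a\<^sup>2 \<le> 1" using a by (simp add: power_le_one)
  have "(\<lambda>n. (if n = 0 then 2 * a else 0) - involution_coeff a n * r ^ n) sums (2 * a - (a - r) / (1 - a * r))"
    using sums_moebius_quotient[of a r] ar sums_single[of 0 "\<lambda>_. 2 * a"]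
    by (intro sums_diff) (auto simp: involution_coeff_def abs_mult)
  also have "(\<lambda>n. (if n = 0 then 2 * a else 0) - involution_coeff a n * r ^ n) = (\<lambda>n. norm (complex_of_real (involution_coeff a n)) * r ^ n)"
  proof
    show "(if n = 0 then 2 * a else 0) - involution_coeff a n * r ^ n = norm (complex_of_real (involution_coeff a n)) * r ^ n" for n
      unfolding norm_of_real using a a2 by (cases "n = 0") (simp_all add: involution_coeff_def abs_mult, simp add: algebra_simps)
  qed
  also have "2 * a - (a - r) / (1 - a * r) = a + (1 - a\<^sup>2) * (r / (1 - a * r))"
    using ar by (simp add: divide_simps) (simp add: power2_eq_square algebra_simps)
  finally have A: "(\<lambda>n. norm (complex_of_real (involution_coeff a n)) * r ^ n) sums (a + (1 - a\<^sup>2) * (r / (1 - a * r)))" .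
  let ?s = "k * (1 - a\<^sup>2) / a\<^sup>2 * (a * r / (1 - a * r) + ln (1 - a * r))"
  have "extremal_g k a (of_real r) = of_real (- ?s)"
  proof -
    have "Ln (1 - complex_of_real a * complex_of_real r) = of_real (ln (1 - a * r))"
      using Ln_of_real[of "1 - a * r"] ar by simp
    then show ?thesis by (simp add: extremal_g_def)
  qed
  with sums_extremal_g[OF a, of "of_real r" k] r
  have "(\<lambda>n. complex_of_real (extremal_g_coeff k a (n + 2) * r ^ (n + 2))) sums of_real (- ?s)"
    by simp
  then have "(\<lambda>n. extremal_g_coeff k a (n + 2) * r ^ (n + 2)) sums - ?s"
    unfolding sums_of_real_iff .
  from sums_minus[OF this]
  have "(\<lambda>n. - extremal_g_coeff k a (n + 2) * r ^ (n + 2)) sums ?s" by simp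
  also have "(\<lambda>n. - extremal_g_coeff k a (n + 2) * r ^ (n + 2)) = (\<lambda>n. norm (complex_of_real (extremal_g_coeff k a (n + 2))) * r ^ (n + 2))"
  proof
    fix n
    have "0 \<le> k * (1 - a\<^sup>2) * (1 - 1 / real (n + 2)) * a ^ n"
      using a a2 k by (intro mult_nonneg_nonneg) auto
    then have "extremal_g_coeff k a (n + 2) \<le> 0" by (simp add: extremal_g_coeff_def)
    then show "- extremal_g_coeff k a (n + 2) * r ^ (n + 2) = norm (complex_of_real (extremal_g_coeff k a (n + 2))) * r ^ (n + 2)"
      unfolding norm_of_real by simp
  qed
  finally have B: "(\<lambda>n. norm (complex_of_real (extremal_g_coeff k a (n + 2))) * r ^ (n + 2)) sums ?s" .
  show ?thesis
    unfolding bohr_sum_def sums_unique[OF A, symmetric] sums_unique[OF B, symmetric]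
    by (simp add: distrib_left mult_ac)
qed

text \<open>The quantity is continuous in \<open>a\<close>, and at \<open>a = 1\<close> it becomes the left-hand side of the equation
  for \<open>R\<close>.\<close>

lemma exists_violating_parameter:
  fixes K r :: real
  assumes K: "K \<ge> 1" and r: "0 < r" "r < 1"
    and R: "4 * r / (1 - r) * (K / (K + 1)) + 2 * ((K - 1) / (K + 1)) * ln (1 - r) > 1"
  obtains a where "0 < a" "a < 1"
    "(1 + a) * (r / (1 - a * r) + (K - 1) / (K + 1) / a\<^sup>2 * (a * r / (1 - a * r) + ln (1 - a * r))) > 1"
proof -
  let ?T = "\<lambda>a::real. (1 + a) * (r / (1 - a * r) + (K - 1) / (K + 1) / a\<^sup>2 * (a * r / (1 - a * r) + ln (1 - a * r)))"
  have "(?T \<longlongrightarrow> ?T 1) (at_left 1)"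
    using r by (intro tendsto_intros) auto
  moreover have "?T 1 = 4 * r / (1 - r) * (K / (K + 1)) + 2 * ((K - 1) / (K + 1)) * ln (1 - r)"
  proof -
    define q s where "q = (K - 1) / (K + 1)" and "s = r / (1 - r)"
    have K': "K / (K + 1) = (1 + (K - 1) / (K + 1)) / 2" using K by (simp add: divide_simps)
    have "?T 1 = 2 * (s + q * (s + ln (1 - r)))" by (simp add: q_def s_def)
    also have "\<dots> = 4 * s * ((1 + q) / 2) + 2 * q * ln (1 - r)" by (simp add: algebra_simps)
    also have "\<dots> = 4 * r / (1 - r) * (K / (K + 1)) + 2 * ((K - 1) / (K + 1)) * ln (1 - r)"
      by (simp only: s_def q_def K' times_divide_eq_right)
    finally show ?thesis .
  qed
  ultimately have "\<forall>\<^sub>F a in at_left 1. ?T a > 1"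
    using R by (intro order_tendstoD(1)[where y = "?T 1"]) auto
  moreover have "\<forall>\<^sub>F a in at_left (1::real). a \<in> {0<..<1}"
    by (rule eventually_at_left_real[OF zero_less_one])
  ultimately have "\<forall>\<^sub>F a in at_left 1. ?T a > 1 \<and> a \<in> {0<..<1}"
    by (rule eventually_conj)
  then show ?thesis
    using that eventually_happens'[of "at_left (1::real)"] by auto
qed

theorem theorem6:
  fixes K :: real
  assumes "K \<ge> 1"
  shows "(\<exists>!rK. is_rK K rK) \<and> (\<exists>!R. is_R K R) \<and>
    (\<forall>rK f h g a b r. is_rK K rK \<and> bounded_qc_harmonic K f h g a b \<and> 0 \<le> r \<and> r \<le> rK
       \<longrightarrow> bohr_sum a b r \<le> sup_norm h) \<and>
    (\<forall>R r. is_R K R \<and> R < r \<and> r < 1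
       \<longrightarrow> (\<exists>f h g a b. bounded_qc_harmonic K f h g a b \<and> \<not> bohr_sum a b r \<le> sup_norm h))"
proof (intro conjI allI impI)
  show "\<exists>!rK. is_rK K rK" "\<exists>!R. is_R K R"
    using ex1_is_rK[OF assms] ex1_is_R[OF assms] .
  show "bohr_sum a b r \<le> sup_norm h"
    if "is_rK K rK \<and> bounded_qc_harmonic K f h g a b \<and> 0 \<le> r \<and> r \<le> rK" for rK f h g a b r
    using bohr_inequality[OF assms] that by blast
  fix R r :: real assume Rr: "is_R K R \<and> R < r \<and> r < 1"
  define k where "k = (K - 1) / (K + 1)"
  have r: "0 < r" "r < 1" using Rr by (auto simp: is_R_def)
  have "4 * r / (1 - r) * (K / (K + 1)) + 2 * ((K - 1) / (K + 1)) * ln (1 - r) > 1"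
    using strict_mono_onD[OF strict_mono_on_R_equation[OF assms], of R r] Rr by (simp add: is_R_def)
  then obtain a where a: "0 < a" "a < 1" and
    gt: "(1 + a) * (r / (1 - a * r) + (K - 1) / (K + 1) / a\<^sup>2 * (a * r / (1 - a * r) + ln (1 - a * r))) > 1"
    using exists_violating_parameter[OF assms r] by blast
  define X where "X = r / (1 - a * r) + k / a\<^sup>2 * (a * r / (1 - a * r) + ln (1 - a * r))"
  have X: "(1 + a) * X > 1" using gt by (simp only: X_def k_def)
  have qc: "bounded_qc_harmonic K (\<lambda>z. disk_involution a z + cnj (extremal_g k a z)) (disk_involution a) (extremal_g k a)
    (\<lambda>n. of_real (involution_coeff a n)) (\<lambda>n. of_real (extremal_g_coeff k a n))"
    by (rule bounded_qc_harmonic_extremal[OF assms a k_def])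
  have "sup_norm (disk_involution a) \<le> 1"
    unfolding sup_norm_def
  proof (rule cSUP_least)
    show "norm (disk_involution a z) \<le> 1" if "z \<in> \<D>" for z
      using disk_involution_self_map(1)[OF a] imageI[OF that, of "disk_involution a"] by simp
  qed simp
  also have "1 < a + (1 - a) * ((1 + a) * X)"
  proof -
    have "1 - a < Y" if "Y = (1 - a) * ((1 + a) * X)" for Y
      using mult_strict_left_mono[OF X, of "1 - a"] a unfolding that by simp
    from this[OF refl] show ?thesis by (simp only: diff_less_eq add.commute)
  qed
  also have "\<dots> = a + (1 - a\<^sup>2) * X"
    by (simp add: power2_eq_square algebra_simps)
  also have "\<dots> = bohr_sum (\<lambda>n. of_real (involution_coeff a n)) (\<lambda>n. of_real (extremal_g_coeff k a n)) r"
    unfolding X_def using assms by (intro bohr_sum_extremal[symmetric] a r) (simp add: k_def)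
  finally show "\<exists>f h g a b. bounded_qc_harmonic K f h g a b \<and> \<not> bohr_sum a b r \<le> sup_norm h"
    using qc by (meson not_le)
qed

end
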